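(* For all $0<\varepsilon,\delta<1$ there exists $n_0$ such that the following holds for every $n\ge n_0$. Let $k\ge 2$ and let $G$ be a $k$-partite graph with parts $V_1,\ldots,V_k$, each of size exactly $n$. If the partite minimum degree of $G$ is at least $\left(1-\frac{1-\delta}{k}\right)n$, then $G$ contains at least $(1-\varepsilon)n$ pairwise vertex-disjoint copies of the complete graph $K_k$.
   Context: A $k$-partite graph with parts $V_1,\ldots,V_k$ is a graph on the disjoint union $V_1\cup\cdots\cup V_k$ with no edges inside any part. The partite minimum degree of such a graph is the largest $d$ such that every vertex has at least $d$ neighbours in each part other than its own. Quantities such as $(1-\varepsilon)n$ are understood up to rounding. *)

theory Defs
  imports Complex_Main "HOL-Library.Ramsey" "HOL-Library.Disjoint_Sets"
begin

text \<open>A simple graph on the vertex set \<open>W\<close> is given by its edge set \<open>E \<subseteq> nsets W 2\<close>; this is the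
  representation for which HOL-Library defines \<^const>\<open>clique\<close>.
  The parts are \<open>V 0, \<dots>, V (k - 1)\<close>; the values \<open>V i\<close> with \<open>i \<ge> k\<close> are irrelevant.\<close>

definition partite_graph :: "nat \<Rightarrow> (nat \<Rightarrow> 'a set) \<Rightarrow> 'a set set \<Rightarrow> bool" where
  "partite_graph k V E \<longleftrightarrow>
     disjoint_family_on V {..<k} \<and>
     E \<subseteq> nsets (\<Union>i<k. V i) 2 \<and>
     (\<forall>i<k. \<forall>e\<in>E. \<not> e \<subseteq> V i)"

definition partite_min_degree :: "nat \<Rightarrow> (nat \<Rightarrow> 'a set) \<Rightarrow> 'a set set \<Rightarrow> nat" where
  "partite_min_degree k V E =
     (GREATEST d. \<forall>i<k. \<forall>v\<in>V i. \<forall>j<k. j \<noteq> i \<longrightarrow> d \<le> card {u \<in> V j. {v, u} \<in> E})"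

text \<open>The maximum exists as soon as there are two nonempty parts.\<close>

lemma le_partite_min_degree_iff:
  assumes "k \<ge> 2" and ne: "\<And>i. i < k \<Longrightarrow> V i \<noteq> {}"
  shows "d \<le> partite_min_degree k V E \<longleftrightarrow>
    (\<forall>i<k. \<forall>v\<in>V i. \<forall>j<k. j \<noteq> i \<longrightarrow> d \<le> card {u \<in> V j. {v, u} \<in> E})"
proof -
  define P where "P d \<longleftrightarrow>
    (\<forall>i<k. \<forall>v\<in>V i. \<forall>j<k. j \<noteq> i \<longrightarrow> d \<le> card {u \<in> V j. {v, u} \<in> E})" for d
  obtain v where v: "v \<in> V 0" using ne[of 0] assms(1) by auto
  have bound: "d \<le> card {u \<in> V 1. {v, u} \<in> E}" if "P d" for d
    using that[unfolded P_def, rule_format, of 0 v 1] v assms(1) by simp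
  have "P 0" by (simp add: P_def)
  then have greatest: "P (Greatest P)" by (rule GreatestI_nat) (use bound in blast)
  have "d \<le> Greatest P \<longleftrightarrow> P d"
  proof
    assume "d \<le> Greatest P"
    with greatest show "P d" unfolding P_def by (meson le_trans)
  next
    assume "P d"
    then show "d \<le> Greatest P" by (rule Greatest_le_nat) (use bound in blast)
  qed
  then show ?thesis unfolding partite_min_degree_def P_def .
qed

text \<open>A copy of \<open>K\<^sub>m\<close> is identified with its vertex set.\<close>

definition complete_copies :: "nat \<Rightarrow> 'a set \<Rightarrow> 'a set set \<Rightarrow> 'a set set" where
  "complete_copies m W E = {C \<in> nsets W m. clique C E}"

end

theory Submission
  imports Defs "HOL-Real_Asymp.Real_Asymp"
begin

text \<open>
  Number every part by \<open>{..<n}\<close> and call two nonadjacent vertices of different parts in conflict; every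
  vertex has at most \<open>d\<close> conflicts with each other part, where \<open>k d \<le> (1 - \<delta>) n\<close>.

  Few parts (\<open>k < k\<^sub>0(\<delta>)\<close>, \<open>n\<close> large): remove cliques one at a time so that the conflict degrees into the
  remaining parts shrink in proportion to the parts. A potential that is a sum of exponentials of the
  ratios, linearised, asks for a clique whose weight is at least the average, and a greedy choice
  averaged over the cyclic orders of the parts finds one.

  Many parts (\<open>k \<ge> k\<^sub>0(\<delta>)\<close>, every \<open>n\<close>): extend \<open>n\<close> disjoint partial cliques simultaneously, one part at a
  time, by a minimum-cost perfect matching. If the matching were random with marginals at most
  \<open>(1 + \<theta>) / (n p\<^sub>j)\<close> in round \<open>j\<close>, where \<open>p\<^sub>j = 1 - j \<beta>\<close>, each pair of a partial clique and a vertex of part \<open>m\<close>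
  would be free of conflicts with probability at least \<open>p\<^sub>m\<close>. A potential over \<open>r\<close>-tuples of vertices
  forces the actual partial cliques to look like that, and this pseudorandomness is in turn what
  guarantees the existence of a fractional perfect matching with these marginals in the next round.
\<close>

section \<open>Hall and Egervary\<close>

text \<open>\<open>n\<^sub>0\<close> may not depend on k, and this forces two arguments. Both
  average the first-order change of a potential; they differ in the fluctuation that remains.
  Removing cliques takes at most n steps that move a ratio by O(1/n): fluctuation n^(-1/2), harmless
  only against a much larger slack \<delta>/k. Building all cliques in parallel takes k steps that
  move a count of order n by O(n/k): relative fluctuation k^(-1/2), small for large k whatever n is.

  The numbers p_j come from telescoping. With marginals at most (1 + \<theta>)/(n p_j), a pair free
  so far is hit in round j with probability at most (1 + \<theta>) d/(n p_j) <= \<beta>/p_j, so it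
  stays free up to part m with probability at least the product of 1 - \<beta>/p_j = p_(j+1)/p_j,
  which is p_m.

  The matching needs enough unhit pairs in every large rectangle S x T. There are too many
  rectangles to enter them in a potential, but r-th moments over tuples control all of them at once.
  Only a small proportion of bad tuples has to be excluded, not every bad tuple, and therefore no
  relation between n and k is required.\<close>

theorem hall_marriage:
  assumes "finite A" and "\<And>x. x \<in> A \<Longrightarrow> finite (N x)"
    and "\<And>S. S \<subseteq> A \<Longrightarrow> card S \<le> card (\<Union>x\<in>S. N x)"
  shows "\<exists>f. inj_on f A \<and> (\<forall>x\<in>A. f x \<in> N x)"
  using assms
proof (induction "card A" arbitrary: A N rule: less_induct)
  case (less A N)
  show ?case
  proof (cases "A = {}")
    case True
    then show ?thesis by simp
  next
    case False
    then obtain x where x: "x \<in> A" by blast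
    have finU: "finite (\<Union>y\<in>S. N y)" if "S \<subseteq> A" for S
      using that less.prems(1,2) by (meson finite_UN finite_subset subset_eq)
    \<comment> \<open>Halmos and Vaughan's induction: a tight set is matched first and the rest
      outside its neighbours; without tight sets every nonempty proper subset has a neighbour to
      spare, so an arbitrary edge can be fixed.\<close>
    show ?thesis
    proof (cases "\<exists>S. S \<subset> A \<and> S \<noteq> {} \<and> card (\<Union>y\<in>S. N y) = card S")
      case True
      then obtain S where S: "S \<subset> A" "S \<noteq> {}" "card (\<Union>y\<in>S. N y) = card S" by blast
      let ?U = "\<Union>y\<in>S. N y"
      have finS: "finite S" using S(1) less.prems(1) by (meson finite_subset psubset_imp_subset)
      have "\<exists>f. inj_on f S \<and> (\<forall>x\<in>S. f x \<in> N x)"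
        using S(1) less.prems by (intro less.hyps) (auto intro: psubset_card_mono finS)
      then obtain f where f: "inj_on f S" "\<forall>x\<in>S. f x \<in> N x" by blast
      have "\<exists>g. inj_on g (A - S) \<and> (\<forall>x\<in>A - S. g x \<in> N x - ?U)"
      proof (rule less.hyps)
        show "card (A - S) < card A"
          using S less.prems(1) by (intro psubset_card_mono) auto
        show "card R \<le> card (\<Union>y\<in>R. N y - ?U)" if R: "R \<subseteq> A - S" for R
        proof -
          have finR: "finite R" using R less.prems(1) by (meson Diff_subset finite_subset)
          have "card S + card R = card (S \<union> R)"
            using R finS finR by (intro card_Un_disjoint[symmetric]) auto
          also have "\<dots> \<le> card (\<Union>y\<in>S \<union> R. N y)"
            using R S(1) by (intro less.prems(3)) auto
          also have "(\<Union>y\<in>S \<union> R. N y) = ?U \<union> (\<Union>y\<in>R. N y - ?U)" by auto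
          also have "card \<dots> \<le> card ?U + card (\<Union>y\<in>R. N y - ?U)" by (rule card_Un_le)
          finally show ?thesis using S(3) by simp
        qed
      qed (use less.prems in auto)
      then obtain g where g: "inj_on g (A - S)" "\<forall>x\<in>A - S. g x \<in> N x - ?U" by blast
      let ?h = "\<lambda>x. if x \<in> S then f x else g x"
      have "inj_on ?h A"
      proof (rule inj_onI)
        fix y z assume yz: "y \<in> A" "z \<in> A" "?h y = ?h z"
        have "f a \<noteq> g b" if "a \<in> S" "b \<in> A - S" for a b
          using f(2) g(2) that by fastforce
        then show "y = z"
          using yz f(1) g(1)
          by (smt (verit, ccfv_threshold) Diff_iff inj_onD)
      qed
      moreover have "\<forall>x\<in>A. ?h x \<in> N x" using f(2) g(2) by auto
      ultimately show ?thesis by blast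
    next
      case no_tight: False
      have "card {x} \<le> card (\<Union>y\<in>{x}. N y)" using x by (intro less.prems(3)) auto
      then obtain y where y: "y \<in> N x" by fastforce
      have "\<exists>g. inj_on g (A - {x}) \<and> (\<forall>z\<in>A - {x}. g z \<in> N z - {y})"
      proof (rule less.hyps)
        show "card (A - {x}) < card A" using x less.prems(1) by (meson card_Diff1_less)
        show "card R \<le> card (\<Union>z\<in>R. N z - {y})" if R: "R \<subseteq> A - {x}" for R
        proof (cases "R = {}")
          case False
          have "card R < card (\<Union>z\<in>R. N z)"
            using no_tight less.prems(3)[of R] False R x
            by (metis Diff_iff Diff_subset le_neq_implies_less psubsetI singletonI subset_iff
                subset_trans)
          then have "card R \<le> card ((\<Union>z\<in>R. N z) - {y})"
            by (subst card_Diff_singleton_if) auto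
          moreover have "(\<Union>z\<in>R. N z - {y}) = (\<Union>z\<in>R. N z) - {y}" by auto
          ultimately show ?thesis by simp
        qed simp
      qed (use less.prems in auto)
      then obtain g where g: "inj_on g (A - {x})" "\<forall>z\<in>A - {x}. g z \<in> N z - {y}" by blast
      have "inj_on (g(x := y)) A"
        using g by (auto simp: inj_on_def)
      moreover have "\<forall>z\<in>A. (g(x := y)) z \<in> N z" using g(2) y by auto
      ultimately show ?thesis by blast
    qed
  qed
qed

text \<open>Hall's condition in the form that the dual argument produces: a Hall violator and the
  set of its non-neighbours have no \<open>ok\<close> pair between them and more than n elements
  together.\<close>

lemma perfect_matching_if_no_large_independent_pair:
  fixes n :: nat
  assumes indep: "\<And>S T. S \<subseteq> {..<n} \<Longrightarrow> T \<subseteq> {..<n} \<Longrightarrow> card S + card T > n \<Longrightarrow>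
    \<exists>c\<in>S. \<exists>v\<in>T. ok c v"
  shows "\<exists>\<pi>. bij_betw \<pi> {..<n} {..<n} \<and> (\<forall>c<n. ok c (\<pi> c))"
proof -
  have "\<exists>f. inj_on f {..<n} \<and> (\<forall>x\<in>{..<n}. f x \<in> {v. v < n \<and> ok x v})"
  proof (rule hall_marriage)
    fix S assume S: "S \<subseteq> {..<n}"
    let ?U = "\<Union>x\<in>S. {v. v < n \<and> ok x v}"
    show "card S \<le> card ?U"
    proof (rule ccontr)
      assume "\<not> card S \<le> card ?U"
      moreover have "card ({..<n} - ?U) = n - card ?U"
        by (subst card_Diff_subset) (auto intro: finite_subset[of _ "{..<n}"])
      moreover have "card ?U \<le> n"
        using card_mono[of "{..<n}" ?U] by auto
      ultimately have "card S + card ({..<n} - ?U) > n" by simp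
      from indep[OF S _ this] show False using S by auto
    qed
  qed auto
  then obtain f where f: "inj_on f {..<n}" "\<forall>x<n. f x < n \<and> ok x (f x)" by auto
  then have "f ` {..<n} = {..<n}"
    by (intro endo_inj_surj) auto
  with f show ?thesis by (auto simp: bij_betw_def)
qed

lemma card_integer_levels:
  fixes L a :: int
  assumes "-L \<le> a" "a \<le> L"
  shows "card {\<theta>\<in>{1 - L..L}. \<theta> \<le> a} = nat (a + L)"
    and "card {\<theta>\<in>{1 - L..L}. 1 - a \<le> \<theta>} = nat (a + L)"
proof -
  have "{\<theta>\<in>{1 - L..L}. \<theta> \<le> a} = {1 - L..a}" "{\<theta>\<in>{1 - L..L}. 1 - a \<le> \<theta>} = {1 - a..L}"
    using assms by auto
  then show "card {\<theta>\<in>{1 - L..L}. \<theta> \<le> a} = nat (a + L)"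
    and "card {\<theta>\<in>{1 - L..L}. 1 - a \<le> \<theta>} = nat (a + L)" by (simp_all add: algebra_simps)
qed

definition edges_between :: "(nat \<Rightarrow> nat \<Rightarrow> bool) \<Rightarrow> nat set \<Rightarrow> nat set \<Rightarrow> nat" where
  "edges_between ok S T = (\<Sum>c\<in>S. card {v\<in>T. ok c v})"

text \<open>The layer-cake form of weak duality: integrating the cut condition over the level sets of a
  dual solution bounds its value.\<close>

lemma dual_value_le:
  fixes a b :: "nat \<Rightarrow> int" and \<psi> :: "nat \<Rightarrow> nat \<Rightarrow> nat" and K :: real
  assumes K: "K \<ge> 0"
    and cut: "\<And>S T. S \<subseteq> {..<n} \<Longrightarrow> T \<subseteq> {..<n} \<Longrightarrow>
      real (card S) + real (card T) - real n \<le> K * real (edges_between ok S T)"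
    and dual: "\<And>c v. c < n \<Longrightarrow> v < n \<Longrightarrow> ok c v \<Longrightarrow> a c + b v \<le> int (\<psi> c v)"
  shows "real_of_int ((\<Sum>c<n. a c) + (\<Sum>v<n. b v)) \<le>
    K * (\<Sum>c<n. \<Sum>v<n. if ok c v then real (\<psi> c v) else 0)"
proof -
  \<comment> \<open>All dual values lie in [-L, L]. Over the 2 L integer levels, c lies in
    \<open>S \<theta>\<close> for \<open>a c + L\<close> of them and v in \<open>T \<theta>\<close>
    for \<open>b v + L\<close>; these offsets cancel against the 2 L n that the cut terms
    subtract.\<close>
  define L where "L = (\<Sum>c<n. \<bar>a c\<bar>) + (\<Sum>v<n. \<bar>b v\<bar>)"
  have La: "\<bar>a c\<bar> \<le> L" if "c < n" for c
  proof -
    have "\<bar>a c\<bar> \<le> (\<Sum>c<n. \<bar>a c\<bar>)" using that by (intro member_le_sum) auto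
    moreover have "0 \<le> (\<Sum>v<n. \<bar>b v\<bar>)" by (intro sum_nonneg) auto
    ultimately show ?thesis unfolding L_def by linarith
  qed
  have Lb: "\<bar>b v\<bar> \<le> L" if "v < n" for v
  proof -
    have "\<bar>b v\<bar> \<le> (\<Sum>c<n. \<bar>b c\<bar>)" using that by (intro member_le_sum) auto
    moreover have "0 \<le> (\<Sum>v<n. \<bar>a v\<bar>)" by (intro sum_nonneg) auto
    ultimately show ?thesis unfolding L_def by linarith
  qed
  have L0: "0 \<le> L" unfolding L_def by (intro add_nonneg_nonneg sum_nonneg) auto
  let ?I = "{1 - L..L}"
  define S where "S \<theta> = {c. c < n \<and> \<theta> \<le> a c}" for \<theta>
  define T where "T \<theta> = {v. v < n \<and> 1 - b v \<le> \<theta>}" for \<theta>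
  have swap: "(\<Sum>\<theta>\<in>?I. real (card {x. x < n \<and> P \<theta> x})) = (\<Sum>x<n. real (card {\<theta>\<in>?I. P \<theta> x}))"
    for P :: "int \<Rightarrow> nat \<Rightarrow> bool"
  proof -
    have "(\<Sum>\<theta>\<in>?I. real (card {x. x < n \<and> P \<theta> x})) = (\<Sum>\<theta>\<in>?I. \<Sum>x<n. of_bool (P \<theta> x))"
      by (intro sum.cong) (auto simp: sum.If_cases of_bool_def Int_def)
    also have "\<dots> = (\<Sum>x<n. \<Sum>\<theta>\<in>?I. of_bool (P \<theta> x))" by (rule sum.swap)
    also have "\<dots> = (\<Sum>x<n. real (card {\<theta>\<in>?I. P \<theta> x}))"
      by (intro sum.cong) (auto simp: sum.If_cases of_bool_def Int_def)
    finally show ?thesis .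
  qed
  have Ssum: "(\<Sum>\<theta>\<in>?I. real (card (S \<theta>))) = (\<Sum>c<n. real_of_int (a c + L))"
    unfolding S_def swap
  proof (intro sum.cong refl)
    fix c assume "c \<in> {..<n}"
    then show "real (card {\<theta>\<in>?I. \<theta> \<le> a c}) = real_of_int (a c + L)"
      using La[of c] by (subst card_integer_levels(1)) (auto simp: abs_le_iff)
  qed
  have Tsum: "(\<Sum>\<theta>\<in>?I. real (card (T \<theta>))) = (\<Sum>v<n. real_of_int (b v + L))"
    unfolding T_def swap
  proof (intro sum.cong refl)
    fix c assume "c \<in> {..<n}"
    then show "real (card {\<theta>\<in>?I. 1 - b c \<le> \<theta>}) = real_of_int (b c + L)"
      using Lb[of c] by (subst card_integer_levels(2)) (auto simp: abs_le_iff)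
  qed
  have "real_of_int ((\<Sum>c<n. a c) + (\<Sum>v<n. b v)) =
      (\<Sum>\<theta>\<in>?I. real (card (S \<theta>)) + real (card (T \<theta>)) - real n)"
    using L0 by (simp add: sum.distrib sum_subtractf Ssum Tsum)
  also have "\<dots> \<le> (\<Sum>\<theta>\<in>?I. K * real (edges_between ok (S \<theta>) (T \<theta>)))"
    by (intro sum_mono cut) (auto simp: S_def T_def)
  also have "\<dots> = K * (\<Sum>\<theta>\<in>?I. real (edges_between ok (S \<theta>) (T \<theta>)))"
    by (simp add: sum_distrib_left)
  also have "(\<Sum>\<theta>\<in>?I. real (edges_between ok (S \<theta>) (T \<theta>))) =
      (\<Sum>\<theta>\<in>?I. \<Sum>c<n. \<Sum>v<n. of_bool (ok c v \<and> \<theta> \<le> a c \<and> 1 - b v \<le> \<theta>))"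
  proof (intro sum.cong refl)
    fix \<theta>
    have "real (edges_between ok (S \<theta>) (T \<theta>)) = (\<Sum>c\<in>S \<theta>. \<Sum>v<n. of_bool (ok c v \<and> 1 - b v \<le> \<theta>))"
      unfolding edges_between_def of_nat_sum
      by (intro sum.cong) (auto simp: sum.If_cases of_bool_def Int_def T_def intro!: arg_cong[where f = card])
    also have "\<dots> = (\<Sum>c<n. \<Sum>v<n. of_bool (ok c v \<and> \<theta> \<le> a c \<and> 1 - b v \<le> \<theta>))"
      by (rule sum.mono_neutral_cong_left) (auto simp: S_def)
    finally show "real (edges_between ok (S \<theta>) (T \<theta>)) = \<dots>" .
  qed
  also have "\<dots> = (\<Sum>c<n. \<Sum>v<n. \<Sum>\<theta>\<in>?I. of_bool (ok c v \<and> \<theta> \<le> a c \<and> 1 - b v \<le> \<theta>))"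
    by (subst sum.swap) (intro sum.cong refl sum.swap)
  also have "\<dots> \<le> (\<Sum>c<n. \<Sum>v<n. if ok c v then real (\<psi> c v) else 0)"
  proof (intro sum_mono)
    fix c v assume cv: "c \<in> {..<n}" "v \<in> {..<n}"
    show "(\<Sum>\<theta>\<in>?I. of_bool (ok c v \<and> \<theta> \<le> a c \<and> 1 - b v \<le> \<theta>)) \<le>
        (if ok c v then real (\<psi> c v) else 0)"
    proof (cases "ok c v")
      case True
      have "(\<Sum>\<theta>\<in>?I. of_bool (ok c v \<and> \<theta> \<le> a c \<and> 1 - b v \<le> \<theta>)) =
          real (card {\<theta>\<in>?I. \<theta> \<le> a c \<and> 1 - b v \<le> \<theta>})"
        using True by (auto simp: sum.If_cases of_bool_def Int_def)
      \<comment> \<open>An \<open>ok\<close> pair is counted at the levels from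
        \<open>1 - b v\<close> to \<open>a c\<close>, that is \<open>a c + b v\<close> times if this
        is positive.\<close>
      also have "\<dots> \<le> real (card {1 - b v..a c})"
        by (intro of_nat_mono card_mono) auto
      also have "\<dots> \<le> real (\<psi> c v)" using dual[of c v] True cv by auto
      finally show ?thesis using True by simp
    qed simp
  qed
  finally show ?thesis using K by (simp add: mult_left_mono)
qed

text \<open>A maximum integral dual exists, and by Hall its tight edges carry a perfect matching: a Hall
  violator would allow the dual to be increased (Egervary's argument).\<close>

lemma min_cost_matching_nat:
  fixes \<psi> :: "nat \<Rightarrow> nat \<Rightarrow> nat" and K :: real
  assumes K: "K \<ge> 0"
    and cut: "\<And>S T. S \<subseteq> {..<n} \<Longrightarrow> T \<subseteq> {..<n} \<Longrightarrow>
      real (card S) + real (card T) - real n \<le> K * real (edges_between ok S T)"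
  shows "\<exists>\<pi>. bij_betw \<pi> {..<n} {..<n} \<and> (\<forall>c<n. ok c (\<pi> c)) \<and>
    real (\<Sum>c<n. \<psi> c (\<pi> c)) \<le> K * (\<Sum>c<n. \<Sum>v<n. if ok c v then real (\<psi> c v) else 0)"
proof -
  define feas where "feas a b \<longleftrightarrow> (\<forall>c<n. \<forall>v<n. ok c v \<longrightarrow> a c + b v \<le> int (\<psi> c v))"
    for a b :: "nat \<Rightarrow> int"
  define val where "val a b = (\<Sum>c<n. a c) + (\<Sum>v<n. b v)" for a b :: "nat \<Rightarrow> int"
  define B where "B = K * (\<Sum>c<n. \<Sum>v<n. if ok c v then real (\<psi> c v) else 0)"
  have bound: "real_of_int (val a b) \<le> B" if "feas a b" for a b
    unfolding val_def B_def
    by (rule dual_value_le[OF K cut]) (use that in \<open>auto simp: feas_def\<close>)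
  define P where "P m \<longleftrightarrow> (\<exists>a b. feas a b \<and> val a b = int m)" for m :: nat
  have P0: "P 0" unfolding P_def by (intro exI[of _ "\<lambda>_. 0"]) (auto simp: feas_def val_def)
  have Pb: "m \<le> nat \<lfloor>B\<rfloor>" if Pm: "P m" for m
  proof -
    obtain a b where ab: "feas a b" "val a b = int m" using Pm unfolding P_def by blast
    have "real m \<le> B" using bound[OF ab(1)] ab(2) by simp
    then show ?thesis by (simp add: le_nat_floor)
  qed
  define m where "m = Greatest P"
  have Pm: "P m" unfolding m_def by (rule GreatestI_nat[where P = P and k = 0, OF P0]) (rule Pb)
  have mmax: "m' \<le> m" if "P m'" for m'
    unfolding m_def by (rule Greatest_le_nat[where P = P, OF that]) (rule Pb)
  obtain a b where ab: "feas a b" "val a b = int m" using Pm P_def by blast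
  have "\<exists>\<pi>. bij_betw \<pi> {..<n} {..<n} \<and> (\<forall>c<n. ok c (\<pi> c) \<and> a c + b (\<pi> c) = int (\<psi> c (\<pi> c)))"
  proof (rule perfect_matching_if_no_large_independent_pair)
    fix S T assume S: "S \<subseteq> {..<n}" and T: "T \<subseteq> {..<n}" and large: "card S + card T > n"
    show "\<exists>c\<in>S. \<exists>v\<in>T. ok c v \<and> a c + b v = int (\<psi> c v)"
    proof (rule ccontr)
      assume none: "\<not> ?thesis"
      \<comment> \<open>The shifted dual gains card S + card T - n > 0. It stays feasible because
        \<open>ok\<close> pairs between S and T are not tight and their slack, being an integer, is
        at least 1.\<close>
      define a' where "a' c = a c + of_bool (c \<in> S)" for c
      define b' where "b' v = b v - of_bool (v \<notin> T)" for v
      have "feas a' b'" unfolding feas_def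
      proof (intro allI impI)
        fix c v assume cv: "c < n" "v < n" "ok c v"
        have "a c + b v \<le> int (\<psi> c v)" using ab(1) cv by (auto simp: feas_def)
        moreover have "a c + b v \<noteq> int (\<psi> c v)" if "c \<in> S" "v \<in> T" using none that cv by blast
        ultimately show "a' c + b' v \<le> int (\<psi> c v)" by (auto simp: a'_def b'_def)
      qed
      have "(\<Sum>c<n. of_bool (c \<in> S)) = int (card S)"
        using S by (auto simp: sum.If_cases of_bool_def Int_absorb1 intro!: arg_cong[where f = card])
      moreover have "(\<Sum>v<n. of_bool (v \<notin> T)) = int n - int (card T)"
      proof -
        have "(\<Sum>v<n. of_bool (v \<notin> T)) = int (card ({..<n} - T))"
          by (auto simp: sum.If_cases of_bool_def Int_def intro!: arg_cong[where f = card])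
        then show ?thesis
          using T card_mono[of "{..<n}" T] by (simp add: card_Diff_subset finite_subset of_nat_diff)
      qed
      ultimately have "val a' b' = val a b + (int (card S) + int (card T) - int n)"
        by (simp add: val_def a'_def b'_def sum.distrib sum_subtractf)
      then have "val a' b' > int m" using large ab(2) by simp
      then have "P (nat (val a' b'))" "nat (val a' b') > m"
        using \<open>feas a' b'\<close> by (auto simp: P_def)
      then show False using mmax by force
    qed
  qed
  then obtain \<pi> where \<pi>: "bij_betw \<pi> {..<n} {..<n}"
    "\<And>c. c < n \<Longrightarrow> ok c (\<pi> c) \<and> a c + b (\<pi> c) = int (\<psi> c (\<pi> c))" by blast
  have "int (\<Sum>c<n. \<psi> c (\<pi> c)) = (\<Sum>c<n. a c + b (\<pi> c))"
    using \<pi>(2) by simp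
  also have "\<dots> = val a b"
    using sum.reindex_bij_betw[OF \<pi>(1), of b] by (simp add: val_def sum.distrib)
  finally have "real (\<Sum>c<n. \<psi> c (\<pi> c)) \<le> B" using bound[OF ab(1)] by (metis of_int_of_nat_eq)
  with \<pi> show ?thesis unfolding B_def by blast
qed

text \<open>By max-flow min-cut, the cut condition says that the \<open>ok\<close> pairs carry a
  fractional perfect matching with entries at most K. Its cost is at most the right-hand side, and
  some integral matching is no worse. Real costs reduce to natural ones by rounding N times the cost
  down; the error n / N vanishes as N grows.\<close>

lemma min_cost_matching:
  fixes \<phi> :: "nat \<Rightarrow> nat \<Rightarrow> real" and K :: real
  assumes K: "K \<ge> 0"
    and cut: "\<And>S T. S \<subseteq> {..<n} \<Longrightarrow> T \<subseteq> {..<n} \<Longrightarrow>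
      real (card S) + real (card T) - real n \<le> K * real (edges_between ok S T)"
    and nonneg: "\<And>c v. c < n \<Longrightarrow> v < n \<Longrightarrow> 0 \<le> \<phi> c v"
  shows "\<exists>\<pi>. bij_betw \<pi> {..<n} {..<n} \<and> (\<forall>c<n. ok c (\<pi> c)) \<and>
    (\<Sum>c<n. \<phi> c (\<pi> c)) \<le> K * (\<Sum>c<n. \<Sum>v<n. \<phi> c v)"
proof -
  define B where "B = K * (\<Sum>c<n. \<Sum>v<n. \<phi> c v)"
  \<comment> \<open>Extensional functions, so that there are finitely many matchings and a single
    one is optimal for all N.\<close>
  define matchings where "matchings = {\<pi> \<in> {..<n} \<rightarrow>\<^sub>E {..<n}. bij_betw \<pi> {..<n} {..<n} \<and> (\<forall>c<n. ok c (\<pi> c))}"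
  define cost where "cost \<pi> = (\<Sum>c<n. \<phi> c (\<pi> c))" for \<pi>
  have approx: "\<exists>\<pi>\<in>matchings. real N * cost \<pi> \<le> real N * B + real n" for N
  proof -
    obtain \<pi> where \<pi>: "bij_betw \<pi> {..<n} {..<n}" "\<forall>c<n. ok c (\<pi> c)"
      "real (\<Sum>c<n. nat \<lfloor>real N * \<phi> c (\<pi> c)\<rfloor>) \<le>
        K * (\<Sum>c<n. \<Sum>v<n. if ok c v then real (nat \<lfloor>real N * \<phi> c v\<rfloor>) else 0)"
      using min_cost_matching_nat[OF K cut, where \<psi> = "\<lambda>c v. nat \<lfloor>real N * \<phi> c v\<rfloor>"] by blast
    have \<pi>n: "\<pi> c < n" if "c < n" for c using \<pi>(1) that by (auto simp: bij_betw_def)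
    define \<pi>' where "\<pi>' = restrict \<pi> {..<n}"
    have "\<pi>' \<in> matchings" using \<pi> \<pi>n bij_betw_cong[of "{..<n}" \<pi> \<pi>' "{..<n}"] by (auto simp: \<pi>'_def matchings_def)
    have "real N * cost \<pi>' = (\<Sum>c<n. real N * \<phi> c (\<pi> c))"
      by (simp add: cost_def \<pi>'_def sum_distrib_left)
    also have "\<dots> \<le> (\<Sum>c<n. real (nat \<lfloor>real N * \<phi> c (\<pi> c)\<rfloor>) + 1)"
      by (intro sum_mono) linarith
    also have "\<dots> = real (\<Sum>c<n. nat \<lfloor>real N * \<phi> c (\<pi> c)\<rfloor>) + real n"
      by (simp add: sum.distrib)
    also have "\<dots> \<le> K * (\<Sum>c<n. \<Sum>v<n. real N * \<phi> c v) + real n"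
    proof -
      have "(\<Sum>c<n. \<Sum>v<n. if ok c v then real (nat \<lfloor>real N * \<phi> c v\<rfloor>) else 0)
          \<le> (\<Sum>c<n. \<Sum>v<n. real N * \<phi> c v)"
        using nonneg by (intro sum_mono) (auto intro!: of_nat_floor mult_nonneg_nonneg)
      then show ?thesis using \<pi>(3) K by (smt (verit) mult_left_mono)
    qed
    also have "\<dots> = real N * B + real n" by (simp add: B_def sum_distrib_left algebra_simps)
    finally show ?thesis using \<open>\<pi>' \<in> matchings\<close> by blast
  qed
  have "finite matchings" unfolding matchings_def by (intro finite_Collect_conjI disjI1) (simp add: finite_PiE)
  moreover have "matchings \<noteq> {}" using approx[of 1] by auto
  ultimately obtain \<pi> where \<pi>: "\<pi> \<in> matchings" "\<And>\<pi>'. \<pi>' \<in> matchings \<Longrightarrow> cost \<pi> \<le> cost \<pi>'"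
    using ex_is_arg_min_if_finite[of matchings cost] unfolding is_arg_min_linorder by blast
  have "cost \<pi> \<le> B"
  proof (rule ccontr)
    assume "\<not> cost \<pi> \<le> B"
    then obtain N :: nat where N: "real n < real N * (cost \<pi> - B)"
      using reals_Archimedean3[of "cost \<pi> - B"] by auto
    obtain \<pi>' where "\<pi>' \<in> matchings" "real N * cost \<pi>' \<le> real N * B + real n" using approx by blast
    with \<pi>(2) have "real N * cost \<pi> \<le> real N * B + real n"
      by (meson mult_left_mono of_nat_0_le_iff order_trans)
    with N show False by (simp add: algebra_simps)
  qed
  with \<pi>(1) show ?thesis unfolding matchings_def cost_def B_def by blast
qed

section \<open>Pseudorandom bipartite graphs\<close>

lemma real_card_filter: "finite A \<Longrightarrow> real (card {x\<in>A. P x}) = (\<Sum>x\<in>A. of_bool (P x))"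
  by (simp add: sum.If_cases of_bool_def Int_def)

lemma sum_card_filter_swap:
  assumes "finite A" "finite B"
  shows "(\<Sum>x\<in>A. real (card {y\<in>B. P x y})) = (\<Sum>y\<in>B. real (card {x\<in>A. P x y}))"
  unfolding real_card_filter[OF assms(1)] real_card_filter[OF assms(2)] by (rule sum.swap)

text \<open>Convexity of x^(r + 1). In the induction, x times the previous tangent exceeds the next
  tangent by a nonnegative multiple of (x - z)^2.\<close>

lemma power_tangent_le:
  fixes x z :: real
  assumes "0 \<le> x" "0 \<le> z"
  shows "z ^ Suc r + real (Suc r) * z ^ r * (x - z) \<le> x ^ Suc r"
proof (induction r)
  case (Suc r)
  have "z ^ Suc (Suc r) + real (Suc (Suc r)) * z ^ Suc r * (x - z)
      \<le> z ^ Suc (Suc r) + real (Suc (Suc r)) * z ^ Suc r * (x - z) + real (Suc r) * z ^ r * (x - z)\<^sup>2"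
    using assms by simp
  also have "\<dots> = x * (z ^ Suc r + real (Suc r) * z ^ r * (x - z))"
    by (simp add: algebra_simps power2_eq_square)
  also have "\<dots> \<le> x * x ^ Suc r" using Suc assms by (intro mult_left_mono) auto
  finally show ?case by simp
qed simp

lemma sum_power_ge:
  fixes x :: "'b \<Rightarrow> real"
  assumes "\<And>c. c \<in> S \<Longrightarrow> 0 \<le> x c" "0 \<le> z" "real (card S) * z \<le> (\<Sum>c\<in>S. x c)" "0 < r"
  shows "real (card S) * z ^ r \<le> (\<Sum>c\<in>S. x c ^ r)"
proof -
  obtain q where r: "r = Suc q" using assms(4) by (cases r) auto
  have "real (card S) * z ^ r \<le> real (card S) * z ^ r + real r * z ^ q * ((\<Sum>c\<in>S. x c) - real (card S) * z)"
    using assms by simp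
  also have "\<dots> = (\<Sum>c\<in>S. z ^ Suc q + real (Suc q) * z ^ q * (x c - z))"
    by (simp add: r sum.distrib sum_distrib_left[symmetric] sum_subtractf)
  also have "\<dots> \<le> (\<Sum>c\<in>S. x c ^ r)"
    unfolding r using assms by (intro sum_mono power_tangent_le) auto
  finally show ?thesis .
qed

lemma edges_between_sym: "finite S \<Longrightarrow> finite T \<Longrightarrow>
    edges_between ok S T = edges_between (\<lambda>v c. ok c v) T S"
proof -
  assume fin: "finite S" "finite T"
  have "edges_between ok S T = (\<Sum>c\<in>S. \<Sum>v\<in>T. of_bool (ok c v))"
    unfolding edges_between_def using fin by (intro sum.cong) (auto simp: sum.If_cases of_bool_def Int_def)
  also have "\<dots> = (\<Sum>v\<in>T. \<Sum>c\<in>S. of_bool (ok c v))" by (rule sum.swap)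
  also have "\<dots> = edges_between (\<lambda>v c. ok c v) T S"
    unfolding edges_between_def using fin by (intro sum.cong) (auto simp: sum.If_cases of_bool_def Int_def)
  finally show ?thesis .
qed

lemma edges_between_ge_rows:
  fixes S T :: "nat set" and D :: real
  assumes "S \<subseteq> {..<n}" "T \<subseteq> {..<n}"
    and row: "\<And>c. c < n \<Longrightarrow> real (card {u. u < n \<and> h c u}) \<le> D"
  shows "real (card S) * (real (card T) - D) \<le> real (edges_between (\<lambda>c u. \<not> h c u) S T)"
proof -
  have "real (card T) - D \<le> real (card {u\<in>T. \<not> h c u})" if "c \<in> S" for c
  proof -
    have fT: "finite T" using assms(2) finite_subset by blast
    have "card T = card ({u\<in>T. h c u} \<union> {u\<in>T. \<not> h c u})" by (intro arg_cong[where f = card]) auto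
    also have "\<dots> = card {u\<in>T. h c u} + card {u\<in>T. \<not> h c u}"
      using fT by (intro card_Un_disjoint) auto
    finally have "real (card T) = real (card {u\<in>T. h c u}) + real (card {u\<in>T. \<not> h c u})" by simp
    moreover have "card {u\<in>T. h c u} \<le> card {u. u < n \<and> h c u}"
      using assms(2) by (intro card_mono) auto
    ultimately show ?thesis using row[of c] that assms(1) by force
  qed
  then have "(\<Sum>c\<in>S. real (card T) - D) \<le> (\<Sum>c\<in>S. real (card {u\<in>T. \<not> h c u}))"
    by (intro sum_mono)
  then show ?thesis by (simp add: edges_between_def)
qed

text \<open>If few \<open>r\<close>-tuples are entirely hit by noticeably more than the expected number of rows, then by
  convexity of the \<open>r\<close>-th power every large combinatorial rectangle contains about as many unhit
  pairs as it should.\<close>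

lemma cut_condition_from_tuples:
  fixes h :: "nat \<Rightarrow> nat \<Rightarrow> bool" and p \<theta> \<zeta> D :: real
  assumes n: "0 < n" and r: "0 < r" and \<theta>: "0 < \<theta>" "\<theta> < 1" and p: "\<theta> \<le> p" "p \<le> 1" and \<zeta>: "0 < \<zeta>"
    and D: "D \<le> (1 - p) * real n"
    and row: "\<And>c. c < n \<Longrightarrow> real (card {u. u < n \<and> h c u}) \<le> D"
    and col: "\<And>u. u < n \<Longrightarrow> real (card {c. c < n \<and> h c u}) \<le> D"
    and tuples: "real (card {\<tau> \<in> {..<r} \<rightarrow>\<^sub>E {..<n}.
        ((1 - p) ^ r + 2 * \<zeta>) * real n < real (card {c. c < n \<and> (\<forall>a<r. h c (\<tau> a))})})
        \<le> 2 * \<zeta> * real n ^ r"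
    and par1: "2 \<le> \<theta> * (1 + \<theta>\<^sup>2 / 2) ^ r"
    and par2: "8 * \<zeta> < \<theta> * \<theta> ^ r * (\<theta>\<^sup>2 / 2) ^ r"
    and S: "S \<subseteq> {..<n}" and T: "T \<subseteq> {..<n}"
  shows "real (card S) + real (card T) - real n \<le>
    (1 + \<theta>) / (real n * p) * real (edges_between (\<lambda>c u. \<not> h c u) S T)"
proof (cases "real (card S) + real (card T) - real n \<le> 0")
  case True
  have "0 \<le> (1 + \<theta>) / (real n * p) * real (edges_between (\<lambda>c u. \<not> h c u) S T)"
    using \<theta> p by (intro mult_nonneg_nonneg divide_nonneg_nonneg) auto
  with True show ?thesis by linarith
next
  case False
  define s where "s = real (card S)"
  define t where "t = real (card T)"
  define e where "e = real (edges_between (\<lambda>c u. \<not> h c u) S T)"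
  have fin: "finite S" "finite T" using S T finite_subset by blast+
  have "card S \<le> card {..<n}" "card T \<le> card {..<n}" by (intro card_mono S T; simp)+
  then have st: "0 \<le> s" "s \<le> real n" "0 \<le> t" "t \<le> real n" by (auto simp: s_def t_def)
  have pos: "0 < s + t - real n" using False by (simp add: s_def t_def)
  have goal: "s + t - real n \<le> (1 + \<theta>) / (real n * p) * e"
    if "real n * p * (s + t - real n) \<le> (1 + \<theta>) * e"
    using that n p \<theta> by (simp add: field_simps)
  have nD: "real n * p \<le> real n - D" using D by (simp add: algebra_simps)
  have e0: "0 \<le> e" by (simp add: e_def)
  have rows: "s * (t - D) \<le> e"
    unfolding s_def t_def e_def by (rule edges_between_ge_rows[OF S T row])
  have cols: "t * (s - D) \<le> e"
    unfolding s_def t_def e_def edges_between_sym[OF fin]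
    by (rule edges_between_ge_rows[OF T S col])
  have small: "real n * p * (s + t - real n) \<le> (1 + \<theta>) * e" if "(real n - D) * (s + t - real n) \<le> e"
  proof -
    have "real n * p * (s + t - real n) \<le> (real n - D) * (s + t - real n)"
      using pos nD by (intro mult_right_mono) auto
    also have "\<dots> \<le> e" by (rule that)
    also have "\<dots> \<le> (1 + \<theta>) * e" using \<theta> e0 by (simp add: algebra_simps)
    finally show ?thesis .
  qed
  have "s + t - real n \<le> (1 + \<theta>) / (real n * p) * e"
  \<comment> \<open>If one side has at most n - D elements, counting by degrees suffices. Otherwise
    both sides exceed n - D >= \<theta> n, and only then are the tuples used.\<close>
  proof (cases "t \<le> real n - D \<or> s \<le> real n - D")
    case True
    then show ?thesis
    proof
      assume "t \<le> real n - D"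
      then have "0 \<le> (real n - D - t) * (real n - s)" using st by simp
      with cols have "(real n - D) * (s + t - real n) \<le> e" by (simp add: algebra_simps)
      then show ?thesis by (intro goal small)
    next
      assume "s \<le> real n - D"
      then have "0 \<le> (real n - D - s) * (real n - t)" using st by simp
      with rows have "(real n - D) * (s + t - real n) \<le> e" by (simp add: algebra_simps)
      then show ?thesis by (intro goal small)
    qed
  next
    case large: False
    have pn: "\<theta> * real n \<le> real n * p" using p n by simp
    have sl: "\<theta> * real n \<le> s" "\<theta> * real n \<le> t" using large nD pn by linarith+
    have spos: "0 < s" "0 < t" using sl n \<theta> by (smt (verit) mult_pos_pos of_nat_0_less_iff)+
    show ?thesis
    proof (rule goal, rule ccontr)
      assume "\<not> real n * p * (s + t - real n) \<le> (1 + \<theta>) * e"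
      then have "(1 + \<theta>) * e < p * (real n * (s + t - real n))" by (simp add: algebra_simps)
      also have "\<dots> \<le> p * (s * t)"
      proof (rule mult_left_mono)
        have "0 \<le> (real n - s) * (real n - t)" using st by simp
        then show "real n * (s + t - real n) \<le> s * t" by (simp add: algebra_simps)
      qed (use p \<theta> in simp)
      finally have e_lt: "e < p / (1 + \<theta>) * (s * t)" using \<theta> by (simp add: field_simps)
      \<comment> \<open>If the claim fails, the rows in S hit on average more than a proportion z of
        T. This exceeds the expected q by p \<theta>/(1 + \<theta>) >= \<theta>^2/2, because p >=
        \<theta> and 1 + \<theta> <= 2.\<close>
      define z where "z = 1 - p / (1 + \<theta>)"
      have "p / (1 + \<theta>) \<le> p / 1" using \<theta> p by (intro divide_left_mono) auto
      then have z0: "0 \<le> z" using p by (simp add: z_def)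
      define q where "q = 1 - p"
      have q: "0 \<le> q" "q \<le> 1" using p \<theta> by (auto simp: q_def)
      have zq: "q + \<theta>\<^sup>2 / 2 \<le> z"
      proof -
        have "\<theta>\<^sup>2 / 2 \<le> p * \<theta> / (1 + \<theta>)"
          unfolding power2_eq_square using \<theta> p by (intro frac_le mult_right_mono) auto
        also have "\<dots> = p - p / (1 + \<theta>)" using \<theta> by (simp add: field_simps)
        finally show ?thesis unfolding z_def q_def by linarith
      qed
      define hit where "hit c = card {u\<in>T. h c u}" for c
      have "real (\<Sum>c\<in>S. hit c) + e = (\<Sum>c\<in>S. real (hit c) + real (card {u\<in>T. \<not> h c u}))"
        by (simp add: e_def edges_between_def sum.distrib)
      also have "\<dots> = (\<Sum>c\<in>S. t)"
      proof (intro sum.cong refl)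
        fix c
        have "card T = card ({u\<in>T. h c u} \<union> {u\<in>T. \<not> h c u})" by (intro arg_cong[where f = card]) auto
        also have "\<dots> = card {u\<in>T. h c u} + card {u\<in>T. \<not> h c u}"
          using fin by (intro card_Un_disjoint) auto
        finally show "real (hit c) + real (card {u\<in>T. \<not> h c u}) = t" by (simp add: hit_def t_def)
      qed
      also have "\<dots> = s * t" by (simp add: s_def)
      finally have hits: "s * (t * z) \<le> (\<Sum>c\<in>S. real (hit c))"
        using e_lt by (simp add: z_def algebra_simps)
      \<comment> \<open>The r-th power of the number of hits of a row counts the r-tuples of T that
        the row hits entirely; convexity turns the surplus on average into a surplus of such
        tuples.\<close>
      have "s * (t * z) ^ r \<le> (\<Sum>c\<in>S. real (hit c) ^ r)"
        unfolding s_def by (rule sum_power_ge) (use hits z0 st r in \<open>auto simp: s_def\<close>)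
      also have "\<dots> = (\<Sum>c\<in>S. \<Sum>\<tau>\<in>{..<r} \<rightarrow>\<^sub>E T. of_bool (\<forall>a<r. h c (\<tau> a)))"
      proof (intro sum.cong refl)
        fix c
        have "real (hit c) ^ r = real (card ({..<r} \<rightarrow>\<^sub>E {u\<in>T. h c u}))"
          unfolding hit_def by (subst card_PiE) simp_all
        also have "{..<r} \<rightarrow>\<^sub>E {u\<in>T. h c u} = {\<tau> \<in> {..<r} \<rightarrow>\<^sub>E T. \<forall>a<r. h c (\<tau> a)}"
          unfolding set_eq_iff PiE_iff mem_Collect_eq by blast
        also have "real (card \<dots>) = (\<Sum>\<tau>\<in>{..<r} \<rightarrow>\<^sub>E T. of_bool (\<forall>a<r. h c (\<tau> a)))"
          using fin by (intro real_card_filter finite_PiE) auto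
        finally show "real (hit c) ^ r = \<dots>" .
      qed
      also have "\<dots> = (\<Sum>\<tau>\<in>{..<r} \<rightarrow>\<^sub>E T. \<Sum>c\<in>S. of_bool (\<forall>a<r. h c (\<tau> a)))" by (rule sum.swap)
      \<comment> \<open>A tuple is entirely hit by at most (q^r + 2 \<zeta>) n rows, unless it is
        one of the few bad ones, for which n is the trivial bound.\<close>
      also have "\<dots> \<le> (\<Sum>\<tau>\<in>{..<r} \<rightarrow>\<^sub>E T. (q ^ r + 2 * \<zeta>) * real n + real n * of_bool
          ((q ^ r + 2 * \<zeta>) * real n < real (card {c. c < n \<and> (\<forall>a<r. h c (\<tau> a))})))"
      proof (intro sum_mono)
        fix \<tau>
        have "(\<Sum>c\<in>S. of_bool (\<forall>a<r. h c (\<tau> a))) = real (card {c\<in>S. \<forall>a<r. h c (\<tau> a)})"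
          using fin by (intro real_card_filter[symmetric])
        moreover have "card {c\<in>S. \<forall>a<r. h c (\<tau> a)} \<le> card {c. c < n \<and> (\<forall>a<r. h c (\<tau> a))}"
          using S by (intro card_mono) auto
        moreover have "card {c. c < n \<and> (\<forall>a<r. h c (\<tau> a))} \<le> card {..<n}"
          by (intro card_mono) auto
        moreover have "0 \<le> (q ^ r + 2 * \<zeta>) * real n" using q \<zeta> by simp
        ultimately show "(\<Sum>c\<in>S. of_bool (\<forall>a<r. h c (\<tau> a))) \<le> (q ^ r + 2 * \<zeta>) * real n + real n * of_bool
          ((q ^ r + 2 * \<zeta>) * real n < real (card {c. c < n \<and> (\<forall>a<r. h c (\<tau> a))}))"
          by (cases "(q ^ r + 2 * \<zeta>) * real n < real (card {c. c < n \<and> (\<forall>a<r. h c (\<tau> a))})") simp_all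
      qed
      also have "\<dots> = t ^ r * ((q ^ r + 2 * \<zeta>) * real n) + real n * real (card {\<tau> \<in> {..<r} \<rightarrow>\<^sub>E T.
          (q ^ r + 2 * \<zeta>) * real n < real (card {c. c < n \<and> (\<forall>a<r. h c (\<tau> a))})})"
        using fin
        by (subst real_card_filter) (simp_all add: sum.distrib sum_distrib_left card_PiE t_def finite_PiE)
      also have "\<dots> \<le> t ^ r * ((q ^ r + 2 * \<zeta>) * real n) + real n * (2 * \<zeta> * real n ^ r)"
      proof -
        have "card {\<tau> \<in> {..<r} \<rightarrow>\<^sub>E T.
          (q ^ r + 2 * \<zeta>) * real n < real (card {c. c < n \<and> (\<forall>a<r. h c (\<tau> a))})} \<le>
          card {\<tau> \<in> {..<r} \<rightarrow>\<^sub>E {..<n}.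
          (q ^ r + 2 * \<zeta>) * real n < real (card {c. c < n \<and> (\<forall>a<r. h c (\<tau> a))})}"
          using T PiE_mono[of "{..<r}" "\<lambda>_. T" "\<lambda>_. {..<n}"]
          by (intro card_mono finite_subset[OF _ finite_PiE[of "{..<r}" "\<lambda>_. {..<n}"]]) auto
        then have "real (card {\<tau> \<in> {..<r} \<rightarrow>\<^sub>E T.
          (q ^ r + 2 * \<zeta>) * real n < real (card {c. c < n \<and> (\<forall>a<r. h c (\<tau> a))})}) \<le> 2 * \<zeta> * real n ^ r"
          using tuples unfolding q_def by linarith
        then show ?thesis by (intro add_left_mono mult_left_mono) auto
      qed
      finally have main: "s * (t * z) ^ r \<le>
        t ^ r * ((q ^ r + 2 * \<zeta>) * real n) + real n * (2 * \<zeta> * real n ^ r)" .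
      \<comment> \<open>The bad tuples are few relative to n^r; since T has at least \<theta> n
        elements, they are few relative to t^r up to the factor \<theta>^r.\<close>
      have nt: "real n ^ r * \<theta> ^ r \<le> t ^ r"
        unfolding power_mult_distrib[symmetric] using sl n \<theta>
        by (intro power_mono) (auto simp: mult.commute)
      have tr: "0 < t ^ r" "0 < \<theta> ^ r" using spos \<theta> by auto
      have "real n * (\<theta> * \<theta> ^ r * z ^ r * t ^ r) = (\<theta> * real n) * (t * z) ^ r * \<theta> ^ r"
        by (simp add: power_mult_distrib)
      also have "\<dots> \<le> s * (t * z) ^ r * \<theta> ^ r"
        using sl tr z0 st by (intro mult_right_mono) auto
      also have "\<dots> \<le> (t ^ r * ((q ^ r + 2 * \<zeta>) * real n) + real n * (2 * \<zeta> * real n ^ r)) * \<theta> ^ r"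
        using main tr by (intro mult_right_mono) auto
      also have "\<dots> = real n * (t ^ r * (q ^ r + 2 * \<zeta>) * \<theta> ^ r + 2 * \<zeta> * (real n ^ r * \<theta> ^ r))"
        by (simp add: algebra_simps)
      also have "\<dots> \<le> real n * (t ^ r * (q ^ r + 2 * \<zeta>) * \<theta> ^ r + 2 * \<zeta> * t ^ r)"
        using nt \<zeta> by (intro mult_left_mono add_left_mono) auto
      also have "\<dots> = real n * ((\<theta> ^ r * (q ^ r + 2 * \<zeta>) + 2 * \<zeta>) * t ^ r)"
        by (simp add: algebra_simps)
      finally have "\<theta> * \<theta> ^ r * z ^ r * t ^ r \<le> (\<theta> ^ r * (q ^ r + 2 * \<zeta>) + 2 * \<zeta>) * t ^ r"
        using n by (subst (asm) mult_le_cancel_left_pos) auto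
      then have "\<theta> * \<theta> ^ r * z ^ r \<le> \<theta> ^ r * (q ^ r + 2 * \<zeta>) + 2 * \<zeta>"
        using tr by simp
      also have "\<dots> \<le> \<theta> ^ r * q ^ r + 4 * \<zeta>"
        using \<zeta> \<theta> power_le_one[of \<theta> r] by (simp add: algebra_simps)
      \<comment> \<open>Half of the left-hand side pays for 4 \<zeta> (\<open>par2\<close>), the
        other half for q^r (\<open>par1\<close>): z is at least \<theta>^2/2 and, as q <= 1, also at
        least (1 + \<theta>^2/2) q.\<close>
      also have "\<dots> < \<theta> ^ r * q ^ r + \<theta> * \<theta> ^ r * (\<theta>\<^sup>2 / 2) ^ r / 2" using par2 by simp
      also have "\<dots> \<le> \<theta> ^ r * (\<theta> * (1 + \<theta>\<^sup>2 / 2) ^ r / 2 * q ^ r) + \<theta> * \<theta> ^ r * (\<theta>\<^sup>2 / 2) ^ r / 2"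
      proof -
        have "1 * q ^ r \<le> \<theta> * (1 + \<theta>\<^sup>2 / 2) ^ r / 2 * q ^ r"
          using par1 q by (intro mult_right_mono) auto
        then show ?thesis using tr by simp
      qed
      also have "\<dots> = \<theta> * \<theta> ^ r * (((1 + \<theta>\<^sup>2 / 2) * q) ^ r + (\<theta>\<^sup>2 / 2) ^ r) / 2"
        unfolding power_mult_distrib[of "1 + \<theta>\<^sup>2 / 2"] by (simp add: distrib_left)
      also have "\<dots> \<le> \<theta> * \<theta> ^ r * (z ^ r + z ^ r) / 2"
      proof -
        have "(1 + \<theta>\<^sup>2 / 2) * q \<le> q + \<theta>\<^sup>2 / 2" using q \<theta> mult_left_le[of q "\<theta>\<^sup>2/2"] by (simp add: algebra_simps)
        then have "((1 + \<theta>\<^sup>2 / 2) * q) ^ r \<le> z ^ r" using zq q \<theta> by (intro power_mono) auto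
        moreover have "(\<theta>\<^sup>2 / 2) ^ r \<le> z ^ r" using zq q \<theta> by (intro power_mono) auto
        ultimately show ?thesis using tr \<theta>
          by (intro divide_right_mono mult_left_mono add_mono) auto
      qed
      finally show False by simp
    qed
  qed
  then show ?thesis by (simp add: s_def t_def e_def)
qed

section \<open>Many parts\<close>

lemma exp_le_quadratic:
  fixes x :: real
  assumes "\<bar>x\<bar> \<le> 1"
  shows "exp x \<le> 1 + x + x\<^sup>2"
proof (cases "0 \<le> x")
  case True
  with assms show ?thesis using exp_bound[of x] by simp
next
  case False
  define y where "y = - x"
  have y: "0 < y" using False by (simp add: y_def)
  \<comment> \<open>The product is 1 + y^3.\<close>
  have "1 \<le> (1 + y) * (1 - y + y\<^sup>2)"
    using y by (simp add: algebra_simps power2_eq_square)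
  also have "\<dots> \<le> exp y * (1 - y + y\<^sup>2)"
  proof (rule mult_right_mono)
    have "0 \<le> (1 - y / 2)\<^sup>2 + 3 / 4 * y\<^sup>2" by simp
    also have "\<dots> = 1 - y + y\<^sup>2" by (simp add: power2_eq_square field_simps)
    finally show "0 \<le> 1 - y + y\<^sup>2" .
  qed simp
  finally have "exp (- y) \<le> 1 - y + y\<^sup>2" by (simp add: exp_minus field_simps)
  then show ?thesis by (simp add: y_def)
qed

locale conflict_system =
  fixes n k d :: nat and Q :: "nat \<Rightarrow> nat \<Rightarrow> nat \<Rightarrow> nat \<Rightarrow> bool"
  assumes Q_sym: "Q i u j v \<longleftrightarrow> Q j v i u"
    and Q_deg: "i < k \<Longrightarrow> j < k \<Longrightarrow> i \<noteq> j \<Longrightarrow> u < n \<Longrightarrow> card {v. v < n \<and> Q i u j v} \<le> d"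

text \<open>\<open>par1\<close> and \<open>par2\<close> are the requirements of
  \<open>cut_condition_from_tuples\<close>. \<open>par3\<close> bounds the tuples on which the
  prediction fails, \<open>par4\<close> those with too many collisions; both hold for large k,
  independently of n.\<close>

locale many_parts = conflict_system +
  fixes \<theta> \<zeta> :: real and r :: nat
  assumes \<theta>: "0 < \<theta>" "\<theta> < 1" and \<zeta>: "0 < \<zeta>" and r: "0 < r" and k: "0 < k" and n: "0 < n"
    and d_le: "(1 + \<theta>) * real d * real k \<le> (1 - \<theta>) * real n"
    and par1: "2 \<le> \<theta> * (1 + \<theta>\<^sup>2 / 2) ^ r"
    and par2: "8 * \<zeta> < \<theta> * \<theta> ^ r * (\<theta>\<^sup>2 / 2) ^ r"
    and par3: "3 * real k * exp (- (\<zeta> * \<theta> * sqrt (real k) / (4 * (real r)\<^sup>2))) \<le> \<zeta>"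
    and par4: "2 / \<theta> * (real r)\<^sup>2 / (\<zeta> * real k) \<le> \<zeta>"
begin

text \<open>In round \<open>j\<close> the \<open>c\<close>-th partial clique receives the vertex \<open>x j c\<close> of part \<open>j\<close>; it hits the vertices of the
  later parts that it conflicts with. \<open>\<rho> m j\<close> is the probability with which a pair not hit before
  round \<open>j\<close> is expected to be hit before round \<open>m\<close>, so \<open>X x j m \<tau>\<close> predicts, at time \<open>j\<close>, how many partial
  cliques will have hit the whole tuple \<open>\<tau>\<close> of part \<open>m\<close> by the time that part is reached. The prediction
  treats the entries of \<open>\<tau>\<close> as independent; \<open>coll\<close> pays for vertices that hit two of them at once.\<close>

definition \<beta> where "\<beta> = (1 - \<theta>) / real k"
definition p where "p i = 1 - real i * \<beta>"
definition \<rho> where "\<rho> m j = 1 - p m / p j"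
definition tuples where "tuples = {..<r} \<rightarrow>\<^sub>E {..<n}"
definition B where "B i m \<tau> v = card {a\<in>{..<r}. Q i v m (\<tau> a)}"
definition coll where "coll i m \<tau> = (\<Sum>v<n. real (B i m \<tau> v * (B i m \<tau> v - 1)))"
definition hit where "hit x j m c u \<longleftrightarrow> (\<exists>i<j. Q i (x i c) m u)"
definition unhit where "unhit x j m \<tau> c = card {a\<in>{..<r}. \<not> hit x j m c (\<tau> a)}"
definition X where "X x j m \<tau> = (\<Sum>c<n. \<rho> m j ^ unhit x j m \<tau> c)"
text \<open>Excess of the prediction over its initial value, plus a reserve for the collisions still
  to come, so that spending the reserve makes Y drift downwards. The price 2 / \<theta> per
  collision bounds n times the marginal (\<open>K_n\<close>).\<close>

definition Y where
  "Y x j m \<tau> = X x j m \<tau> - real n * \<rho> m 0 ^ r + 2 / \<theta> * (\<Sum>i=j..<m. coll i m \<tau>)"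
text \<open>These are the tuples for which Y starts at most at \<zeta> n.\<close>

definition good where "good m = {\<tau>\<in>tuples. 2 / \<theta> * (\<Sum>i=0..<m. coll i m \<tau>) \<le> \<zeta> * real n}"
text \<open>M bounds the change of Y in one round (\<open>Y_Suc_abs\<close>), and \<mu> is chosen so
  that (\<mu> M)^2 = 1/k: the quadratic errors of k rounds then multiply \<Phi> by at most (1 +
  1/k)^k.\<close>

definition M where "M = 4 * (real r)\<^sup>2 * real n / (\<theta> * real k)"
definition \<mu> where "\<mu> = 1 / (M * sqrt (real k))"
definition \<Phi> where "\<Phi> x j = (\<Sum>m=j..<k. \<Sum>\<tau>\<in>good m. exp (\<mu> * Y x j m \<tau>))"
definition partial where "partial x j \<longleftrightarrow> (\<forall>i<j. bij_betw (x i) {..<n} {..<n}) \<and>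
  (\<forall>i<j. \<forall>i'<j. i < i' \<longrightarrow> (\<forall>c<n. \<not> Q i (x i c) i' (x i' c)))"

section \<open>Elementary bounds on the constants\<close>

lemma M_pos: "0 < M"
  unfolding M_def using r n k \<theta> by simp

lemma \<mu>_pos: "0 < \<mu>"
  unfolding \<mu>_def using M_pos k by simp

lemma \<mu>_n: "\<mu> * real n = \<theta> * sqrt (real k) / (4 * (real r)\<^sup>2)"
proof -
  have "sqrt (real k) * sqrt (real k) = real k" by simp
  then show ?thesis
    unfolding \<mu>_def M_def using n k \<theta> r by (simp add: field_simps)
qed

lemma \<mu>_M: "(\<mu> * M)\<^sup>2 = 1 / real k" "\<mu> * M \<le> 1"
proof -
  have "\<mu> * M = 1 / sqrt (real k)" using M_pos by (simp add: \<mu>_def)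
  then show "(\<mu> * M)\<^sup>2 = 1 / real k" "\<mu> * M \<le> 1" using k by (auto simp: power_divide)
qed

lemma \<beta>_pos: "0 < \<beta>" unfolding \<beta>_def using \<theta> k by simp

lemma \<beta>_le: "real n * \<beta> \<le> real n / real k"
  unfolding \<beta>_def using \<theta> by (simp add: divide_right_mono mult_left_le)

lemma d_\<beta>: "(1 + \<theta>) * real d \<le> \<beta> * real n"
  using d_le k by (simp add: \<beta>_def field_simps)

lemma d_\<beta>': "real d \<le> \<beta> * real n"
proof -
  have "real d \<le> (1 + \<theta>) * real d" using \<theta> by (simp add: algebra_simps)
  with d_\<beta> show ?thesis by linarith
qed

lemma d_le_nk: "real d \<le> real n / real k"
  using d_\<beta>' \<beta>_le by (simp add: mult.commute)

lemma p_ge: "i \<le> k \<Longrightarrow> \<theta> \<le> p i"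
proof -
  assume "i \<le> k"
  then have "real i * \<beta> \<le> real k * \<beta>" using \<beta>_pos by simp
  also have "\<dots> = 1 - \<theta>" using k by (simp add: \<beta>_def)
  finally show ?thesis by (simp add: p_def)
qed

lemma p_pos: "i \<le> k \<Longrightarrow> 0 < p i"
  using p_ge[of i] \<theta> by linarith

lemma p_le_1: "p i \<le> 1" unfolding p_def using \<beta>_pos by simp

lemma p_antimono: "i \<le> j \<Longrightarrow> p j \<le> p i" unfolding p_def using \<beta>_pos by simp

lemma \<rho>_bounds: "j \<le> m \<Longrightarrow> m \<le> k \<Longrightarrow> 0 \<le> \<rho> m j" "j \<le> m \<Longrightarrow> m \<le> k \<Longrightarrow> \<rho> m j \<le> 1"
  unfolding \<rho>_def using p_pos[of j] p_pos[of m] p_antimono[of j m] by (auto simp: field_simps)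

lemma \<rho>_self: "m \<le> k \<Longrightarrow> \<rho> m m = 0"
  unfolding \<rho>_def using p_pos[of m] by simp

text \<open>The recursion \<rho> m j = h + (1 - h) \<rho> m (Suc j) with h = \<beta> / p j: an unhit
  pair is hit in round j with probability h, or else possibly later.\<close>

lemma \<rho>_step:
  assumes "Suc j \<le> m" "m \<le> k"
  shows "\<rho> m j - \<rho> m (Suc j) = \<beta> / p j * (1 - \<rho> m (Suc j))"
proof -
  have nz: "p j \<noteq> 0" "p (Suc j) \<noteq> 0" using p_pos[of j] p_pos[of "Suc j"] assms by auto
  have "\<rho> m j - \<rho> m (Suc j) = p m / p (Suc j) - p m / p j" by (simp add: \<rho>_def)
  also have "\<dots> = (p j - p (Suc j)) / p j * (p m / p (Suc j))"
    using nz by (simp add: field_simps)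
  also have "p j - p (Suc j) = \<beta>" by (simp add: p_def algebra_simps)
  finally show ?thesis by (simp add: \<rho>_def)
qed

lemma \<rho>_step_bounds:
  assumes "Suc j \<le> m" "m \<le> k"
  shows "\<rho> m (Suc j) \<le> \<rho> m j" "\<rho> m j - \<rho> m (Suc j) \<le> \<beta> / \<theta>"
proof -
  have pj: "0 < p j" "\<theta> \<le> p j" using p_pos[of j] p_ge[of j] assms by auto
  have b: "0 \<le> 1 - \<rho> m (Suc j)" "1 - \<rho> m (Suc j) \<le> 1"
    using \<rho>_bounds[OF assms] by auto
  have "0 \<le> \<beta> / p j * (1 - \<rho> m (Suc j))" using b pj \<beta>_pos by (intro mult_nonneg_nonneg) auto
  then show "\<rho> m (Suc j) \<le> \<rho> m j" using \<rho>_step[OF assms] by linarith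
  have "\<beta> / p j * (1 - \<rho> m (Suc j)) \<le> \<beta> / p j * 1"
    using b pj \<beta>_pos by (intro mult_left_mono) auto
  also have "\<dots> \<le> \<beta> / \<theta>" using pj \<beta>_pos \<theta> by (simp add: frac_le)
  finally show "\<rho> m j - \<rho> m (Suc j) \<le> \<beta> / \<theta>" using \<rho>_step[OF assms] by linarith
qed

section \<open>Tuples and their collisions\<close>

lemma finite_tuples: "finite tuples"
  unfolding tuples_def by (simp add: finite_PiE)

lemma card_tuples: "real (card tuples) = real n ^ r"
  unfolding tuples_def by (simp add: card_PiE)

lemma finite_good: "finite (good m)"
  unfolding good_def using finite_tuples by simp

lemma tuples_lt: "\<tau> \<in> tuples \<Longrightarrow> a < r \<Longrightarrow> \<tau> a < n"
  unfolding tuples_def by (auto simp: PiE_iff)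

lemma sum_B_le:
  assumes "i < m" "m < k" "\<tau> \<in> tuples"
  shows "(\<Sum>v<n. real (B i m \<tau> v)) \<le> real r * real d"
proof -
  have "(\<Sum>v<n. real (B i m \<tau> v)) = (\<Sum>a<r. real (card {v\<in>{..<n}. Q i v m (\<tau> a)}))"
    unfolding B_def by (rule sum_card_filter_swap) auto
  also have "\<dots> \<le> (\<Sum>a<r. real d)"
  proof (intro sum_mono)
    fix a assume "a \<in> {..<r}"
    then have "card {v. v < n \<and> Q m (\<tau> a) i v} \<le> d"
      using assms tuples_lt by (intro Q_deg) auto
    moreover have "{v\<in>{..<n}. Q i v m (\<tau> a)} = {v. v < n \<and> Q m (\<tau> a) i v}"
      using Q_sym by blast
    ultimately show "real (card {v\<in>{..<n}. Q i v m (\<tau> a)}) \<le> real d" by simp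
  qed
  finally show ?thesis by simp
qed

lemma B_le: "B i m \<tau> v \<le> r"
proof -
  have "B i m \<tau> v \<le> card {..<r}" unfolding B_def by (intro card_mono) auto
  then show ?thesis by simp
qed

lemma coll_nonneg: "0 \<le> coll i m \<tau>"
  unfolding coll_def by (intro sum_nonneg) auto

lemma coll_le:
  assumes "i < m" "m < k" "\<tau> \<in> tuples"
  shows "coll i m \<tau> \<le> (real r)\<^sup>2 * real d"
proof -
  have "coll i m \<tau> \<le> (\<Sum>v<n. real r * real (B i m \<tau> v))"
    unfolding coll_def of_nat_mult[symmetric]
    by (intro sum_mono of_nat_mono) (metis B_le diff_le_self le_trans mult.commute mult_le_mono1)
  also have "\<dots> \<le> real r * (real r * real d)"
    unfolding sum_distrib_left[symmetric] using sum_B_le[OF assms] by (intro mult_left_mono) auto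
  finally show ?thesis by (simp add: power2_eq_square)
qed

text \<open>Two coordinates confined to W leave the proportion (card W / n)^2 of all tuples;
  multiplied out, the exponent r - 2 disappears.\<close>

lemma card_tuples_two_coordinates:
  assumes "a < r" "b < r" "a \<noteq> b" "W \<subseteq> {..<n}"
  shows "real (card {\<tau>\<in>tuples. \<tau> a \<in> W \<and> \<tau> b \<in> W}) * (real n)\<^sup>2 = (real (card W))\<^sup>2 * real n ^ r"
proof -
  have "{\<tau>\<in>tuples. \<tau> a \<in> W \<and> \<tau> b \<in> W} = (\<Pi>\<^sub>E c\<in>{..<r}. if c = a \<or> c = b then W else {..<n})"
  proof (rule set_eqI)
    fix \<tau>
    have "(\<forall>c\<in>{..<r}. \<tau> c \<in> (if c = a \<or> c = b then W else {..<n})) \<longleftrightarrow>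
        (\<forall>c\<in>{..<r}. \<tau> c \<in> {..<n}) \<and> \<tau> a \<in> W \<and> \<tau> b \<in> W"
      using assms by (metis lessThan_iff subsetD)
    then show "\<tau> \<in> {\<tau>\<in>tuples. \<tau> a \<in> W \<and> \<tau> b \<in> W} \<longleftrightarrow>
        \<tau> \<in> (\<Pi>\<^sub>E c\<in>{..<r}. if c = a \<or> c = b then W else {..<n})"
      unfolding tuples_def mem_Collect_eq PiE_iff by blast
  qed
  then have "card {\<tau>\<in>tuples. \<tau> a \<in> W \<and> \<tau> b \<in> W} = (\<Prod>c<r. if c = a \<or> c = b then card W else n)"
    by (simp add: card_PiE if_distrib cong: if_cong)
  also have "\<dots> = card W * (card W * (\<Prod>c\<in>{..<r} - {a} - {b}. n))"
    using assms by (simp add: prod.remove[of _ a] prod.remove[of _ b])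
  also have "(\<Prod>c\<in>{..<r} - {a} - {b}. n) = n ^ (r - 2)"
    using assms by (simp add: numeral_2_eq_2)
  finally have "real (card {\<tau>\<in>tuples. \<tau> a \<in> W \<and> \<tau> b \<in> W}) = (real (card W))\<^sup>2 * real n ^ (r - 2)"
    by (simp add: power2_eq_square)
  moreover have "real n ^ (r - 2) * (real n)\<^sup>2 = real n ^ r"
  proof -
    have "r = r - 2 + 2" using assms by linarith
    then show ?thesis by (metis power_add)
  qed
  ultimately show ?thesis by (simp add: mult.assoc)
qed

lemma card_mult_pred:
  "finite A \<Longrightarrow> real (card A * (card A - 1)) = (\<Sum>a\<in>A. \<Sum>b\<in>A. of_bool (a \<noteq> b))"
proof -
  assume A: "finite A"
  have "(\<Sum>b\<in>A. of_bool (a \<noteq> b)) = real (card A - 1)" if "a \<in> A" for a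
  proof -
    have "(\<Sum>b\<in>A. of_bool (a \<noteq> b)) = real (card {b\<in>A. a \<noteq> b})"
      using A by (simp add: real_card_filter)
    also have "{b\<in>A. a \<noteq> b} = A - {a}" by auto
    finally show ?thesis using that by simp
  qed
  then show ?thesis by simp
qed

text \<open>A collision is a vertex v with an ordered pair of distinct coordinates both in conflict
  with v. There are at most n r^2 such triples, each realised by a proportion at most (d/n)^2 of the
  tuples. As d <= n/k, the average is at most r^2 n/k^2 per round, and r^2 n/k over all
  rounds.\<close>

lemma sum_coll_le:
  assumes "i < m" "m < k"
  shows "(\<Sum>\<tau>\<in>tuples. coll i m \<tau>) \<le> (real r)\<^sup>2 * (real d)\<^sup>2 * real n ^ r / real n"
proof -
  define W where "W v = {u. u < n \<and> Q i v m u}" for v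
  have W: "W v \<subseteq> {..<n}" for v by (auto simp: W_def)
  have cW: "card (W v) \<le> d" if "v < n" for v
    unfolding W_def using assms that by (intro Q_deg) auto
  have "(\<Sum>\<tau>\<in>tuples. coll i m \<tau>) =
      (\<Sum>\<tau>\<in>tuples. \<Sum>v<n. \<Sum>a<r. \<Sum>b<r. of_bool (a \<noteq> b \<and> \<tau> a \<in> W v \<and> \<tau> b \<in> W v))"
  proof (intro sum.cong refl)
    fix \<tau> assume \<tau>: "\<tau> \<in> tuples"
    show "coll i m \<tau> = (\<Sum>v<n. \<Sum>a<r. \<Sum>b<r. of_bool (a \<noteq> b \<and> \<tau> a \<in> W v \<and> \<tau> b \<in> W v))"
      unfolding coll_def
    proof (intro sum.cong refl)
      fix v
      let ?A = "{a\<in>{..<r}. Q i v m (\<tau> a)}"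
      have "real (B i m \<tau> v * (B i m \<tau> v - 1)) = (\<Sum>a\<in>?A. \<Sum>b\<in>?A. of_bool (a \<noteq> b))"
        unfolding B_def by (rule card_mult_pred) simp
      also have "\<dots> = (\<Sum>a\<in>?A. \<Sum>b<r. of_bool (a \<noteq> b \<and> Q i v m (\<tau> b)))"
        by (intro sum.cong sum.mono_neutral_cong_left) auto
      also have "\<dots> = (\<Sum>a<r. \<Sum>b<r. of_bool (a \<noteq> b \<and> Q i v m (\<tau> a) \<and> Q i v m (\<tau> b)))"
        by (intro sum.mono_neutral_cong_left) auto
      also have "\<dots> = (\<Sum>a<r. \<Sum>b<r. of_bool (a \<noteq> b \<and> \<tau> a \<in> W v \<and> \<tau> b \<in> W v))"
        using \<tau> tuples_lt by (intro sum.cong) (auto simp: W_def)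
      finally show "real (B i m \<tau> v * (B i m \<tau> v - 1)) = \<dots>" .
    qed
  qed
  also have "\<dots> = (\<Sum>v<n. \<Sum>a<r. \<Sum>b<r. \<Sum>\<tau>\<in>tuples. of_bool (a \<noteq> b \<and> \<tau> a \<in> W v \<and> \<tau> b \<in> W v))"
  proof (subst sum.swap, intro sum.cong refl)
    fix v
    show "(\<Sum>\<tau>\<in>tuples. \<Sum>a<r. \<Sum>b<r. of_bool (a \<noteq> b \<and> \<tau> a \<in> W v \<and> \<tau> b \<in> W v)) =
      (\<Sum>a<r. \<Sum>b<r. \<Sum>\<tau>\<in>tuples. of_bool (a \<noteq> b \<and> \<tau> a \<in> W v \<and> \<tau> b \<in> W v) :: real)"
      by (subst sum.swap) (intro sum.cong refl sum.swap)
  qed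
  also have "\<dots> \<le> (\<Sum>v<n. \<Sum>a<r. \<Sum>b<r. (real d)\<^sup>2 * real n ^ r / (real n)\<^sup>2)"
  proof (intro sum_mono)
    fix v a b assume v: "v \<in> {..<n}" and a: "a \<in> {..<r}" and b: "b \<in> {..<r}"
    show "(\<Sum>\<tau>\<in>tuples. of_bool (a \<noteq> b \<and> \<tau> a \<in> W v \<and> \<tau> b \<in> W v)) \<le> (real d)\<^sup>2 * real n ^ r / (real n)\<^sup>2"
    proof (cases "a = b")
      case False
      have "(\<Sum>\<tau>\<in>tuples. of_bool (a \<noteq> b \<and> \<tau> a \<in> W v \<and> \<tau> b \<in> W v)) =
          real (card {\<tau>\<in>tuples. \<tau> a \<in> W v \<and> \<tau> b \<in> W v})"
        using False finite_tuples by (simp add: real_card_filter)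
      also have "\<dots> = (real (card (W v)))\<^sup>2 * real n ^ r / (real n)\<^sup>2"
        using card_tuples_two_coordinates[of a b "W v"] a b False W n by (simp add: field_simps)
      also have "\<dots> \<le> (real d)\<^sup>2 * real n ^ r / (real n)\<^sup>2"
        using cW[of v] v by (intro divide_right_mono mult_right_mono power_mono) auto
      finally show ?thesis .
    qed simp
  qed
  also have "\<dots> = (real r)\<^sup>2 * (real d)\<^sup>2 * real n ^ r / real n"
    using n by (simp add: power2_eq_square field_simps)
  finally show ?thesis .
qed

text \<open>Markov's inequality: the average of the reserve is at most (2/\<theta>) r^2 n/k, which
  \<open>par4\<close> bounds by \<zeta>^2 n.\<close>

lemma card_not_good:
  assumes "m < k"
  shows "real (card (tuples - good m)) \<le> \<zeta> * real n ^ r"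
proof -
  have "real (card (tuples - good m)) * (\<zeta> * real n) = (\<Sum>\<tau>\<in>tuples - good m. \<zeta> * real n)" by simp
  also have "\<dots> \<le> (\<Sum>\<tau>\<in>tuples - good m. 2 / \<theta> * (\<Sum>i=0..<m. coll i m \<tau>))"
    by (intro sum_mono) (auto simp: good_def)
  also have "\<dots> \<le> (\<Sum>\<tau>\<in>tuples. 2 / \<theta> * (\<Sum>i=0..<m. coll i m \<tau>))"
    using \<theta> finite_tuples
    by (intro sum_mono2) (auto intro!: mult_nonneg_nonneg divide_nonneg_nonneg sum_nonneg coll_nonneg)
  also have "\<dots> = 2 / \<theta> * (\<Sum>i=0..<m. \<Sum>\<tau>\<in>tuples. coll i m \<tau>)"
    by (subst sum.swap) (simp add: sum_distrib_left)
  also have "\<dots> \<le> 2 / \<theta> * (\<Sum>i=0..<m. (real r)\<^sup>2 * (real n / real k)\<^sup>2 * real n ^ r / real n)"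
  proof (intro mult_left_mono sum_mono)
    fix i assume "i \<in> {0..<m}"
    then have "(\<Sum>\<tau>\<in>tuples. coll i m \<tau>) \<le> (real r)\<^sup>2 * (real d)\<^sup>2 * real n ^ r / real n"
      using assms by (intro sum_coll_le) auto
    also have "\<dots> \<le> (real r)\<^sup>2 * (real n / real k)\<^sup>2 * real n ^ r / real n"
      using d_le_nk by (intro divide_right_mono mult_right_mono mult_left_mono power_mono) auto
    finally show "(\<Sum>\<tau>\<in>tuples. coll i m \<tau>) \<le> \<dots>" .
  qed (use \<theta> in auto)
  also have "\<dots> = 2 / \<theta> * (real m * ((real r)\<^sup>2 * (real n / real k)\<^sup>2 * real n ^ r / real n))" by simp
  also have "\<dots> \<le> 2 / \<theta> * (real k * ((real r)\<^sup>2 * (real n / real k)\<^sup>2 * real n ^ r / real n))"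
    using assms \<theta> by (intro mult_left_mono mult_right_mono) auto
  also have "\<dots> = 2 / \<theta> * (real r)\<^sup>2 / (\<zeta> * real k) * real n ^ r * (\<zeta> * real n)"
    using k n \<zeta> \<theta> by (simp add: field_simps power2_eq_square)
  also have "\<dots> \<le> \<zeta> * real n ^ r * (\<zeta> * real n)"
    using par4 \<zeta> by (intro mult_right_mono) auto
  finally show ?thesis using n \<zeta> by (simp add: mult.commute)
qed

section \<open>From a small potential to the cut condition\<close>

lemma hit_count_row:
  assumes "partial x j" "j < k" "c < n"
  shows "card {u. u < n \<and> hit x j j c u} \<le> j * d"
proof -
  have "{u. u < n \<and> hit x j j c u} = (\<Union>i<j. {u. u < n \<and> Q i (x i c) j u})"
    by (auto simp: hit_def)
  also have "card \<dots> \<le> (\<Sum>i<j. card {u. u < n \<and> Q i (x i c) j u})" by (intro card_UN_le) auto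
  also have "\<dots> \<le> (\<Sum>i<j. d)"
  proof (intro sum_mono Q_deg)
    fix i assume "i \<in> {..<j}"
    then show "x i c < n" using assms by (auto simp: partial_def bij_betw_def)
  qed (use assms in auto)
  finally show ?thesis by simp
qed

text \<open>Every round is a bijection, so the at most d vertices of part i in conflict with u are
  spread over at most d partial cliques.\<close>

lemma hit_count_col:
  assumes "partial x j" "j < k" "u < n"
  shows "card {c. c < n \<and> hit x j j c u} \<le> j * d"
proof -
  have "{c. c < n \<and> hit x j j c u} = (\<Union>i<j. {c. c < n \<and> Q i (x i c) j u})"
    by (auto simp: hit_def)
  also have "card \<dots> \<le> (\<Sum>i<j. card {c. c < n \<and> Q i (x i c) j u})" by (intro card_UN_le) auto
  also have "\<dots> \<le> (\<Sum>i<j. d)"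
  proof (intro sum_mono)
    fix i assume i: "i \<in> {..<j}"
    then have bij: "bij_betw (x i) {..<n} {..<n}" using assms by (auto simp: partial_def)
    have "card {c. c < n \<and> Q i (x i c) j u} \<le> card {v. v < n \<and> Q j u i v}"
    proof (rule card_inj_on_le)
      show "inj_on (x i) {c. c < n \<and> Q i (x i c) j u}"
        using bij by (auto simp: bij_betw_def intro: inj_on_subset)
      show "x i ` {c. c < n \<and> Q i (x i c) j u} \<subseteq> {v. v < n \<and> Q j u i v}"
        using bij Q_sym by (auto simp: bij_betw_def)
    qed auto
    also have "\<dots> \<le> d" using i assms by (intro Q_deg) auto
    finally show "card {c. c < n \<and> Q i (x i c) j u} \<le> d" .
  qed
  finally show ?thesis by simp
qed

text \<open>At time j nothing is left to predict: \<open>\<rho> j j = 0\<close>, and 0 to the power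
  \<open>unhit\<close> is 1 (as 0^0) exactly for the cliques that hit the whole tuple.\<close>

lemma X_self:
  assumes "j \<le> k"
  shows "X x j j \<tau> = real (card {c. c < n \<and> (\<forall>a<r. hit x j j c (\<tau> a))})"
proof -
  have "X x j j \<tau> = (\<Sum>c<n. of_bool (\<forall>a<r. hit x j j c (\<tau> a)))"
    unfolding X_def \<rho>_self[OF assms] unhit_def
    by (intro sum.cong refl) (auto simp: power_0_left)
  then show ?thesis using real_card_filter[of "{..<n}" "\<lambda>c. \<forall>a<r. hit x j j c (\<tau> a)"] by simp
qed

text \<open>Markov's inequality for \<Phi>: a bad good tuple has Y >= 2 \<zeta> n and contributes
  exp (2 \<mu> \<zeta> n), while \<Phi> carries only one factor exp (\<mu> \<zeta> n);
  \<open>par3\<close> turns the quotient into \<zeta>. The second \<zeta> pays for the tuples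
  outside \<open>good j\<close>.\<close>

lemma tuples_bound:
  assumes "j < k" and \<Phi>: "\<Phi> x j \<le> 3 * real k * real n ^ r * exp (\<mu> * (\<zeta> * real n))"
  shows "real (card {\<tau> \<in> {..<r} \<rightarrow>\<^sub>E {..<n}.
        ((1 - p j) ^ r + 2 * \<zeta>) * real n < real (card {c. c < n \<and> (\<forall>a<r. hit x j j c (\<tau> a))})})
        \<le> 2 * \<zeta> * real n ^ r"
    (is "real (card ?bad) \<le> _")
proof -
  have \<rho>0: "\<rho> j 0 = 1 - p j" by (simp add: \<rho>_def p_def)
  have Y: "2 * \<zeta> * real n \<le> Y x j j \<tau>" if "\<tau> \<in> ?bad" for \<tau>
    using that X_self[of j x \<tau>] assms(1) by (simp add: Y_def \<rho>0 algebra_simps)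
  have "real (card (?bad \<inter> good j)) * exp (\<mu> * (2 * \<zeta> * real n)) =
      (\<Sum>\<tau>\<in>?bad \<inter> good j. exp (\<mu> * (2 * \<zeta> * real n)))" by simp
  also have "\<dots> \<le> (\<Sum>\<tau>\<in>?bad \<inter> good j. exp (\<mu> * Y x j j \<tau>))"
  proof (intro sum_mono)
    fix \<tau> assume "\<tau> \<in> ?bad \<inter> good j"
    then have "2 * \<zeta> * real n \<le> Y x j j \<tau>" by (intro Y) blast
    then show "exp (\<mu> * (2 * \<zeta> * real n)) \<le> exp (\<mu> * Y x j j \<tau>)"
      unfolding exp_le_cancel_iff using \<mu>_pos by (intro mult_left_mono) auto
  qed
  also have "\<dots> \<le> (\<Sum>\<tau>\<in>good j. exp (\<mu> * Y x j j \<tau>))"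
    using finite_good by (intro sum_mono2) auto
  also have "\<dots> \<le> \<Phi> x j"
    unfolding \<Phi>_def using assms(1)
    by (intro member_le_sum[of j "{j..<k}" "\<lambda>m. \<Sum>\<tau>\<in>good m. exp (\<mu> * Y x j m \<tau>)"]) (auto intro: sum_nonneg)
  also have "\<dots> \<le> 3 * real k * real n ^ r * exp (\<mu> * (\<zeta> * real n))" by (rule \<Phi>)
  also have "\<dots> = (3 * real k * exp (- (\<mu> * (\<zeta> * real n)))) * real n ^ r * exp (\<mu> * (2 * \<zeta> * real n))"
  proof -
    have "exp (\<mu> * (\<zeta> * real n)) = exp (- (\<mu> * (\<zeta> * real n))) * exp (\<mu> * (2 * \<zeta> * real n))"
      by (simp flip: exp_add)
    then show ?thesis by simp
  qed
  also have "\<dots> \<le> \<zeta> * real n ^ r * exp (\<mu> * (2 * \<zeta> * real n))"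
  proof (intro mult_right_mono)
    have "\<mu> * (\<zeta> * real n) = \<zeta> * \<theta> * sqrt (real k) / (4 * (real r)\<^sup>2)"
      using \<mu>_n by (simp add: mult.left_commute mult.assoc)
    then show "3 * real k * exp (- (\<mu> * (\<zeta> * real n))) \<le> \<zeta>" using par3 by simp
  qed auto
  finally have 1: "real (card (?bad \<inter> good j)) \<le> \<zeta> * real n ^ r" by simp
  have "card ?bad \<le> card ((?bad \<inter> good j) \<union> (tuples - good j))"
    using finite_good finite_tuples by (intro card_mono) (auto simp: tuples_def)
  also have "\<dots> \<le> card (?bad \<inter> good j) + card (tuples - good j)" by (rule card_Un_le)
  finally show ?thesis using 1 card_not_good[OF assms(1)] by linarith
qed

lemma cut_condition:
  assumes "partial x j" "j < k" and "\<Phi> x j \<le> 3 * real k * real n ^ r * exp (\<mu> * (\<zeta> * real n))"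
    and "S \<subseteq> {..<n}" "T \<subseteq> {..<n}"
  shows "real (card S) + real (card T) - real n \<le>
    (1 + \<theta>) / (real n * p j) * real (edges_between (\<lambda>c u. \<not> hit x j j c u) S T)"
proof (rule cut_condition_from_tuples[where D = "real (j * d)", OF n r \<theta> _ p_le_1 \<zeta>])
  show "\<theta> \<le> p j" using assms by (intro p_ge) auto
  have "real j * real d \<le> real j * (\<beta> * real n)" using d_\<beta>' by (intro mult_left_mono) auto
  then show "real (j * d) \<le> (1 - p j) * real n" by (simp add: p_def algebra_simps)
  show "real (card {u. u < n \<and> hit x j j c u}) \<le> real (j * d)" if "c < n" for c
    using hit_count_row[OF assms(1,2) that] by (rule of_nat_mono)
  show "real (card {c. c < n \<and> hit x j j c u}) \<le> real (j * d)" if "u < n" for u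
    using hit_count_col[OF assms(1,2) that] by (rule of_nat_mono)
qed (use tuples_bound[OF assms(2,3)] par1 par2 assms(4,5) in auto)

section \<open>The effect of one round on the predictions\<close>

definition new where
  "new x j m \<tau> c v = card {a\<in>{..<r}. \<not> hit x j m c (\<tau> a) \<and> Q j v m (\<tau> a)}"

text \<open>What clique c adds to X at time j + 1 by receiving v, compared with a vertex that hits
  nothing new. Only this part of X depends on the matching, and it will be the edge cost.\<close>

definition gain where
  "gain x j m \<tau> c v =
    \<rho> m (Suc j) ^ (unhit x j m \<tau> c - new x j m \<tau> c v) - \<rho> m (Suc j) ^ unhit x j m \<tau> c"

lemma new_le: "new x j m \<tau> c v \<le> unhit x j m \<tau> c" "new x j m \<tau> c v \<le> B j m \<tau> v"
  unfolding new_def unhit_def B_def by (intro card_mono; auto)+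

lemma unhit_le: "unhit x j m \<tau> c \<le> r"
proof -
  have "unhit x j m \<tau> c \<le> card {..<r}" unfolding unhit_def by (intro card_mono) auto
  then show ?thesis by simp
qed

lemma unhit_Suc:
  "unhit (x(j := \<pi>)) (Suc j) m \<tau> c = unhit x j m \<tau> c - new x j m \<tau> c (\<pi> c)"
proof -
  have "{a\<in>{..<r}. \<not> hit (x(j := \<pi>)) (Suc j) m c (\<tau> a)} =
    {a\<in>{..<r}. \<not> hit x j m c (\<tau> a)} - {a\<in>{..<r}. \<not> hit x j m c (\<tau> a) \<and> Q j (\<pi> c) m (\<tau> a)}"
    by (auto simp: hit_def less_Suc_eq)
  then show ?thesis unfolding unhit_def new_def
    by (simp only:) (subst card_Diff_subset; auto)
qed

lemma gain_nonneg:
  assumes "Suc j \<le> m" "m \<le> k"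
  shows "0 \<le> gain x j m \<tau> c v"
  unfolding gain_def using \<rho>_bounds[OF assms] by (simp add: power_decreasing)

lemma gain_le_new:
  assumes "Suc j \<le> m" "m \<le> k"
  shows "gain x j m \<tau> c v \<le> real (new x j m \<tau> c v)"
proof (cases "new x j m \<tau> c v = 0")
  case False
  have "gain x j m \<tau> c v \<le> 1"
    unfolding gain_def using \<rho>_bounds[OF assms]
    by (smt (verit) power_le_one zero_le_power)
  with False show ?thesis by linarith
qed (simp add: gain_def)

text \<open>Exact when at most one coordinate is newly hit. With two or more, the gain is at most 1
  and is charged to the collision at v.\<close>

lemma gain_le:
  assumes "Suc j \<le> m" "m \<le> k"
  shows "gain x j m \<tau> c v \<le>
    real (new x j m \<tau> c v) * (\<rho> m (Suc j) ^ (unhit x j m \<tau> c - 1) * (1 - \<rho> m (Suc j)))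
    + real (B j m \<tau> v * (B j m \<tau> v - 1))"
proof -
  let ?w = "new x j m \<tau> c v" and ?s = "unhit x j m \<tau> c" and ?\<rho> = "\<rho> m (Suc j)" and ?B = "B j m \<tau> v"
  have \<rho>: "0 \<le> ?\<rho>" "?\<rho> \<le> 1" using \<rho>_bounds[OF assms] by auto
  consider "?w = 0" | "?w = 1" | "2 \<le> ?w" by linarith
  then show ?thesis
  proof cases
    case 1
    then show ?thesis by (simp add: gain_def)
  next
    case 2
    then have "?s \<ge> 1" using new_le(1) by metis
    then have "?\<rho> ^ ?s = ?\<rho> * ?\<rho> ^ (?s - 1)" by (metis power_eq_if not_one_le_zero)
    then have "gain x j m \<tau> c v = ?\<rho> ^ (?s - 1) * (1 - ?\<rho>)"
      unfolding gain_def 2 by (simp add: algebra_simps)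
    with 2 show ?thesis by simp
  next
    case 3
    have "2 \<le> ?B" using 3 new_le(2)[of x j m \<tau> c v] by linarith
    then have "2 * 1 \<le> ?B * (?B - 1)" by (intro mult_le_mono) auto
    moreover have "gain x j m \<tau> c v \<le> 1"
      unfolding gain_def using \<rho> by (smt (verit) power_le_one zero_le_power)
    moreover have "0 \<le> real ?w * (?\<rho> ^ (?s - 1) * (1 - ?\<rho>))" using \<rho> by simp
    ultimately show ?thesis by linarith
  qed
qed

lemma sum_new_le:
  assumes "j < m" "m < k" "\<tau> \<in> tuples"
  shows "(\<Sum>v<n. real (new x j m \<tau> c v)) \<le> real (unhit x j m \<tau> c) * real d"
proof -
  let ?U = "{a\<in>{..<r}. \<not> hit x j m c (\<tau> a)}"
  have "(\<Sum>v<n. real (new x j m \<tau> c v)) = (\<Sum>v<n. real (card {a\<in>?U. Q j v m (\<tau> a)}))"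
    unfolding new_def by (simp add: conj_assoc)
  also have "\<dots> = (\<Sum>a\<in>?U. real (card {v\<in>{..<n}. Q j v m (\<tau> a)}))"
    by (rule sum_card_filter_swap) auto
  also have "\<dots> \<le> (\<Sum>a\<in>?U. real d)"
  proof (intro sum_mono)
    fix a assume "a \<in> ?U"
    then have "card {v. v < n \<and> Q m (\<tau> a) j v} \<le> d"
      using assms tuples_lt by (intro Q_deg) auto
    moreover have "{v\<in>{..<n}. Q j v m (\<tau> a)} = {v. v < n \<and> Q m (\<tau> a) j v}"
      using Q_sym by blast
    ultimately show "real (card {v\<in>{..<n}. Q j v m (\<tau> a)}) \<le> real d" by simp
  qed
  finally show ?thesis by (simp add: unhit_def)
qed

abbreviation K where "K j \<equiv> (1 + \<theta>) / (real n * p j)"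

lemma K_pos: "j \<le> k \<Longrightarrow> 0 < K j"
  using p_pos[of j] n \<theta> by simp

text \<open>The factor 1 + \<theta> of the marginals is absorbed by (1 + \<theta>) d <= \<beta> n;
  what remains is the rate \<beta> / p j that is built into \<rho>.\<close>

lemma K_d: "j \<le> k \<Longrightarrow> K j * real d \<le> \<beta> / p j"
proof -
  assume "j \<le> k"
  then have "0 < p j" by (rule p_pos)
  have "K j * real d = (1 + \<theta>) * real d / (real n * p j)" by simp
  also have "\<dots> \<le> \<beta> * real n / (real n * p j)"
    using d_\<beta> \<open>0 < p j\<close> by (intro divide_right_mono) auto
  finally show ?thesis using n by simp
qed

lemma K_n: "j \<le> k \<Longrightarrow> real n * K j \<le> 2 / \<theta>"
proof -
  assume "j \<le> k"
  then have "(1 + \<theta>) / p j \<le> 2 / \<theta>" using p_ge[of j] \<theta> by (intro frac_le) auto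
  then show ?thesis using n by simp
qed

text \<open>The weights \<open>\<rho>\<close> are chosen so that the tangent inequality for \<open>x ^ s\<close> makes the expected
  change nonpositive, up to the collisions.\<close>

lemma average_gain_le:
  assumes "j < m" "m < k" "\<tau> \<in> tuples"
  shows "K j * (\<Sum>v<n. gain x j m \<tau> c v) \<le>
    \<rho> m j ^ unhit x j m \<tau> c - \<rho> m (Suc j) ^ unhit x j m \<tau> c + K j * coll j m \<tau>"
proof -
  let ?s = "unhit x j m \<tau> c" and ?\<rho> = "\<rho> m (Suc j)"
  have jm: "Suc j \<le> m" "m \<le> k" using assms by auto
  have \<rho>: "0 \<le> ?\<rho>" "?\<rho> \<le> 1" "0 \<le> \<rho> m j"
    using \<rho>_bounds[OF jm] \<rho>_step_bounds(1)[OF jm] by linarith+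
  define w where "w = ?\<rho> ^ (?s - 1) * (1 - ?\<rho>)"
  have w: "0 \<le> w" using \<rho> by (simp add: w_def)
  have Kj: "0 < K j" using assms by (intro K_pos) auto
  have "(\<Sum>v<n. gain x j m \<tau> c v) \<le>
      (\<Sum>v<n. real (new x j m \<tau> c v) * w + real (B j m \<tau> v * (B j m \<tau> v - 1)))"
    unfolding w_def by (intro sum_mono gain_le jm)
  also have "\<dots> = (\<Sum>v<n. real (new x j m \<tau> c v)) * w + coll j m \<tau>"
    by (simp add: sum.distrib sum_distrib_right coll_def)
  also have "\<dots> \<le> real ?s * real d * w + coll j m \<tau>"
    using sum_new_le[OF assms] w by (intro add_right_mono mult_right_mono)
  finally have "K j * (\<Sum>v<n. gain x j m \<tau> c v) \<le> K j * (real ?s * real d * w + coll j m \<tau>)"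
    using Kj by (intro mult_left_mono) auto
  also have "\<dots> = (K j * real d) * (real ?s * w) + K j * coll j m \<tau>" by (simp only: algebra_simps)
  also have "\<dots> \<le> \<beta> / p j * (real ?s * w) + K j * coll j m \<tau>"
    using K_d[of j] assms w by (intro add_right_mono mult_right_mono) auto
  also have "\<beta> / p j * (real ?s * w) \<le> \<rho> m j ^ ?s - ?\<rho> ^ ?s"
  proof (cases ?s)
    case (Suc q)
    have "\<beta> / p j * (real ?s * w) = real (Suc q) * ?\<rho> ^ q * (\<beta> / p j * (1 - ?\<rho>))"
      by (simp add: w_def Suc)
    also have "\<dots> = real (Suc q) * ?\<rho> ^ q * (\<rho> m j - ?\<rho>)" using \<rho>_step[OF jm] by simp
    also have "\<dots> \<le> \<rho> m j ^ Suc q - ?\<rho> ^ Suc q" using power_tangent_le[of "\<rho> m j" ?\<rho> q] \<rho> by linarith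
    finally show ?thesis by (simp only: Suc)
  qed simp
  finally show ?thesis by linarith
qed

lemma \<rho>_power_diff:
  assumes "Suc j \<le> m" "m \<le> k" "s \<le> r"
  shows "\<rho> m (Suc j) ^ s \<le> \<rho> m j ^ s" "\<rho> m j ^ s - \<rho> m (Suc j) ^ s \<le> real r * (\<beta> / \<theta>)"
proof -
  have \<rho>: "0 \<le> \<rho> m (Suc j)" "\<rho> m (Suc j) \<le> \<rho> m j" "0 \<le> \<rho> m j" "\<rho> m j \<le> 1"
    using \<rho>_bounds[OF assms(1,2)] \<rho>_bounds[of j m] \<rho>_step_bounds(1)[OF assms(1,2)] assms by auto
  then show "\<rho> m (Suc j) ^ s \<le> \<rho> m j ^ s" by (intro power_mono)
  show "\<rho> m j ^ s - \<rho> m (Suc j) ^ s \<le> real r * (\<beta> / \<theta>)"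
  proof (cases s)
    case 0
    then show ?thesis using \<beta>_pos \<theta> by simp
  next
    case (Suc q)
    have "\<rho> m j ^ s - \<rho> m (Suc j) ^ s \<le> real s * \<rho> m j ^ q * (\<rho> m j - \<rho> m (Suc j))"
      using power_tangent_le[of "\<rho> m (Suc j)" "\<rho> m j" q] \<rho> by (simp add: Suc algebra_simps)
    also have "\<dots> \<le> real s * 1 * (\<rho> m j - \<rho> m (Suc j))"
      using \<rho> power_le_one[of "\<rho> m j" q] by (intro mult_right_mono mult_left_mono) auto
    also have "\<dots> \<le> real r * (\<beta> / \<theta>)"
      using \<rho>_step_bounds[OF assms(1,2)] assms(3)
      unfolding mult_1_right by (intro mult_mono) auto
    finally show ?thesis .
  qed
qed

lemma Y_Suc:
  assumes "j < m"
  shows "Y (x(j := \<pi>)) (Suc j) m \<tau> - Y x j m \<tau> = (\<Sum>c<n. gain x j m \<tau> c (\<pi> c))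
    + (\<Sum>c<n. \<rho> m (Suc j) ^ unhit x j m \<tau> c - \<rho> m j ^ unhit x j m \<tau> c) - 2 / \<theta> * coll j m \<tau>"
proof -
  have "(\<Sum>i=j..<m. coll i m \<tau>) = coll j m \<tau> + (\<Sum>i=Suc j..<m. coll i m \<tau>)"
    using assms by (rule sum.atLeast_Suc_lessThan)
  moreover have "X (x(j := \<pi>)) (Suc j) m \<tau> = (\<Sum>c<n. gain x j m \<tau> c (\<pi> c)) +
      (\<Sum>c<n. \<rho> m (Suc j) ^ unhit x j m \<tau> c)"
    unfolding X_def unhit_Suc gain_def by (simp add: sum_subtractf)
  ultimately show ?thesis
    by (simp add: Y_def X_def sum_subtractf algebra_simps)
qed

text \<open>Since \<pi> is a bijection, the gains add up to at most r d <= r n/k instead of n. With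
  w = M/4 = r^2 n/(\<theta> k), the change of \<rho> lowers Y by at most w, and the released reserve
  is at most 2 w.\<close>

lemma Y_Suc_abs:
  assumes "j < m" "m < k" "\<tau> \<in> tuples" and \<pi>: "bij_betw \<pi> {..<n} {..<n}"
  shows "\<bar>Y (x(j := \<pi>)) (Suc j) m \<tau> - Y x j m \<tau>\<bar> \<le> M"
proof -
  have jm: "Suc j \<le> m" "m \<le> k" using assms by auto
  define g where "g = (\<Sum>c<n. gain x j m \<tau> c (\<pi> c))"
  define f where "f = (\<Sum>c<n. \<rho> m (Suc j) ^ unhit x j m \<tau> c - \<rho> m j ^ unhit x j m \<tau> c)"
  define N where "N = real n / real k"
  have N: "0 \<le> N" "real d \<le> N" using d_le_nk by (auto simp: N_def)
  have r1: "1 \<le> real r" using r by simp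
  have rr: "real r \<le> (real r)\<^sup>2" using r1 by (simp add: power2_eq_square)
  have M: "M = 4 * (real r)\<^sup>2 * N / \<theta>" by (simp add: M_def N_def)
  have "0 \<le> g" unfolding g_def by (intro sum_nonneg gain_nonneg jm)
  have "g \<le> (\<Sum>c<n. real (B j m \<tau> (\<pi> c)))"
    unfolding g_def
  proof (intro sum_mono)
    fix c
    have "gain x j m \<tau> c (\<pi> c) \<le> real (new x j m \<tau> c (\<pi> c))" by (rule gain_le_new[OF jm])
    also have "\<dots> \<le> real (B j m \<tau> (\<pi> c))" using new_le(2) by (rule of_nat_mono)
    finally show "gain x j m \<tau> c (\<pi> c) \<le> real (B j m \<tau> (\<pi> c))" .
  qed
  also have "\<dots> = (\<Sum>v<n. real (B j m \<tau> v))" by (rule sum.reindex_bij_betw[OF \<pi>])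
  also have "\<dots> \<le> real r * real d" by (rule sum_B_le[OF assms(1-3)])
  also have "\<dots> \<le> (real r)\<^sup>2 * N" using N rr by (intro mult_mono) auto
  also have "\<dots> \<le> M"
  proof -
    have "(real r)\<^sup>2 * N * \<theta> \<le> (real r)\<^sup>2 * N * 4" using N \<theta> by (intro mult_left_mono) auto
    then show ?thesis unfolding M using \<theta> by (simp add: field_simps)
  qed
  finally have gM: "g \<le> M" .
  have "f \<le> 0" unfolding f_def
    using \<rho>_power_diff(1)[OF jm unhit_le] by (intro sum_nonpos) auto
  have "- f \<le> (\<Sum>c<n. real r * (\<beta> / \<theta>))"
    unfolding f_def sum_negf[symmetric] using \<rho>_power_diff(2)[OF jm unhit_le] by (intro sum_mono) auto
  also have "\<dots> = real r * (real n * \<beta>) / \<theta>" by simp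
  also have "\<dots> \<le> (real r)\<^sup>2 * N / \<theta>"
    using \<beta>_le \<theta> rr \<beta>_pos by (intro divide_right_mono mult_mono) (auto simp: N_def)
  finally have fM: "- f \<le> (real r)\<^sup>2 * N / \<theta>" .
  have c0: "0 \<le> 2 / \<theta> * coll j m \<tau>" using coll_nonneg \<theta> by simp
  have "2 / \<theta> * coll j m \<tau> \<le> 2 / \<theta> * ((real r)\<^sup>2 * N)"
    using coll_le[OF assms(1-3)] N \<theta>
    by (intro mult_left_mono) (auto intro: order_trans[OF _ mult_left_mono])
  then have cM: "2 / \<theta> * coll j m \<tau> \<le> 2 * ((real r)\<^sup>2 * N / \<theta>)" by simp
  have "0 \<le> (real r)\<^sup>2 * N / \<theta>" using N \<theta> by simp
  moreover have "M = 4 * ((real r)\<^sup>2 * N / \<theta>)" by (simp add: M)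
  moreover have "\<bar>g + f - c\<bar> \<le> M"
    if "0 \<le> w" "M = 4 * w" "- f \<le> w" "c \<le> 2 * w" "0 \<le> c" for w c
    using that gM \<open>0 \<le> g\<close> \<open>f \<le> 0\<close> by linarith
  ultimately show ?thesis
    unfolding Y_Suc[OF assms(1)] g_def[symmetric] f_def[symmetric] using fM cM c0 by blast
qed

text \<open>The matching has to make the first-order change of \<Phi> nonpositive. Marginals K j
  would achieve this on average (\<open>average_gain_le\<close>), and
  \<open>min_cost_matching\<close> does at least as well; the second-order error is at most (\<mu>
  M)^2 = 1/k relative to each term.\<close>

lemma extend_step:
  assumes x: "partial x j" and j: "j < k"
    and \<Phi>: "\<Phi> x j \<le> 3 * real k * real n ^ r * exp (\<mu> * (\<zeta> * real n))"
  shows "\<exists>\<pi>. partial (x(j := \<pi>)) (Suc j) \<and> \<Phi> (x(j := \<pi>)) (Suc j) \<le> (1 + 1 / real k) * \<Phi> x j"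
proof -
  define E where "E m \<tau> = exp (\<mu> * Y x j m \<tau>)" for m \<tau>
  have E: "0 < E m \<tau>" for m \<tau> by (simp add: E_def)
  \<comment> \<open>The first-order effect on \<Phi>, up to the factor \<mu>, of giving v to clique
    c.\<close>
  define \<phi> where "\<phi> c v = (\<Sum>m=Suc j..<k. \<Sum>\<tau>\<in>good m. E m \<tau> * gain x j m \<tau> c v)" for c v
  have "\<exists>\<pi>. bij_betw \<pi> {..<n} {..<n} \<and> (\<forall>c<n. \<not> hit x j j c (\<pi> c)) \<and>
    (\<Sum>c<n. \<phi> c (\<pi> c)) \<le> K j * (\<Sum>c<n. \<Sum>v<n. \<phi> c v)"
  proof (rule min_cost_matching)
    show "0 \<le> K j" using K_pos[of j] j by simp
    show "0 \<le> \<phi> c v" for c v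
      unfolding \<phi>_def using E
      by (intro sum_nonneg mult_nonneg_nonneg gain_nonneg) (auto intro: less_imp_le)
  qed (rule cut_condition[OF x j \<Phi>])
  then obtain \<pi> where \<pi>: "bij_betw \<pi> {..<n} {..<n}" "\<And>c. c < n \<Longrightarrow> \<not> hit x j j c (\<pi> c)"
    "(\<Sum>c<n. \<phi> c (\<pi> c)) \<le> K j * (\<Sum>c<n. \<Sum>v<n. \<phi> c v)" by blast
  define x' where "x' = x(j := \<pi>)"
  have "partial x' (Suc j)"
    unfolding partial_def x'_def using x \<pi>(1,2)
    by (auto simp: partial_def less_Suc_eq hit_def)
  define \<Delta> where "\<Delta> m \<tau> = Y x' (Suc j) m \<tau> - Y x j m \<tau>" for m \<tau>
  \<comment> \<open>The part of the change of Y that is the same for all matchings.\<close>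
  define L where "L m \<tau> = (\<Sum>c<n. \<rho> m (Suc j) ^ unhit x j m \<tau> c - \<rho> m j ^ unhit x j m \<tau> c)
    - 2 / \<theta> * coll j m \<tau>" for m \<tau>
  have \<Delta>: "\<Delta> m \<tau> = (\<Sum>c<n. gain x j m \<tau> c (\<pi> c)) + L m \<tau>" if "j < m" for m \<tau>
    unfolding \<Delta>_def x'_def L_def using Y_Suc[OF that] by simp
  have sum\<phi>: "(\<Sum>c<n. \<phi> c (\<pi>' c)) = (\<Sum>m=Suc j..<k. \<Sum>\<tau>\<in>good m. E m \<tau> * (\<Sum>c<n. gain x j m \<tau> c (\<pi>' c)))" for \<pi>'
  proof -
    have "(\<Sum>c<n. \<phi> c (\<pi>' c)) = (\<Sum>m=Suc j..<k. \<Sum>c<n. \<Sum>\<tau>\<in>good m. E m \<tau> * gain x j m \<tau> c (\<pi>' c))"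
      unfolding \<phi>_def by (rule sum.swap)
    also have "\<dots> = (\<Sum>m=Suc j..<k. \<Sum>\<tau>\<in>good m. \<Sum>c<n. E m \<tau> * gain x j m \<tau> c (\<pi>' c))"
      by (intro sum.cong refl sum.swap)
    finally show ?thesis by (simp add: sum_distrib_left)
  qed
  have "(\<Sum>m=Suc j..<k. \<Sum>\<tau>\<in>good m. E m \<tau> * \<Delta> m \<tau>) =
      (\<Sum>c<n. \<phi> c (\<pi> c)) + (\<Sum>m=Suc j..<k. \<Sum>\<tau>\<in>good m. E m \<tau> * L m \<tau>)"
    unfolding sum\<phi> sum.distrib[symmetric] by (intro sum.cong refl) (auto simp: \<Delta> distrib_left)
  also have "\<dots> \<le> K j * (\<Sum>v<n. \<Sum>c<n. \<phi> c v) + (\<Sum>m=Suc j..<k. \<Sum>\<tau>\<in>good m. E m \<tau> * L m \<tau>)"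
    using \<pi>(3) by (subst sum.swap) simp
  also have "\<dots> = (\<Sum>m=Suc j..<k. \<Sum>\<tau>\<in>good m. E m \<tau> * (K j * (\<Sum>v<n. \<Sum>c<n. gain x j m \<tau> c v) + L m \<tau>))"
  proof -
    have "(\<Sum>v<n. \<Sum>c<n. \<phi> c v) = (\<Sum>v<n. \<Sum>m=Suc j..<k. \<Sum>\<tau>\<in>good m. E m \<tau> * (\<Sum>c<n. gain x j m \<tau> c v))"
      using sum\<phi>[of "\<lambda>_. v" for v] by simp
    also have "\<dots> = (\<Sum>m=Suc j..<k. \<Sum>v<n. \<Sum>\<tau>\<in>good m. E m \<tau> * (\<Sum>c<n. gain x j m \<tau> c v))"
      by (rule sum.swap)
    also have "\<dots> = (\<Sum>m=Suc j..<k. \<Sum>\<tau>\<in>good m. \<Sum>v<n. E m \<tau> * (\<Sum>c<n. gain x j m \<tau> c v))"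
      by (intro sum.cong refl sum.swap)
    finally have "K j * (\<Sum>v<n. \<Sum>c<n. \<phi> c v) =
        (\<Sum>m=Suc j..<k. \<Sum>\<tau>\<in>good m. E m \<tau> * (K j * (\<Sum>v<n. \<Sum>c<n. gain x j m \<tau> c v)))"
      by (simp only: sum_distrib_left mult.left_commute)
    then show ?thesis by (simp only: sum.distrib distrib_left)
  qed
  also have "\<dots> \<le> 0"
  proof (intro sum_nonpos mult_nonneg_nonpos less_imp_le[OF E])
    fix m \<tau> assume "m \<in> {Suc j..<k}" "\<tau> \<in> good m"
    then have m: "j < m" "m < k" "\<tau> \<in> tuples" by (auto simp: good_def)
    have "K j * (\<Sum>v<n. \<Sum>c<n. gain x j m \<tau> c v) = (\<Sum>c<n. K j * (\<Sum>v<n. gain x j m \<tau> c v))"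
      by (subst sum.swap) (simp only: sum_distrib_left)
    also have "\<dots> \<le> (\<Sum>c<n. \<rho> m j ^ unhit x j m \<tau> c - \<rho> m (Suc j) ^ unhit x j m \<tau> c + K j * coll j m \<tau>)"
      by (intro sum_mono average_gain_le m)
    also have "\<dots> = (\<Sum>c<n. \<rho> m j ^ unhit x j m \<tau> c - \<rho> m (Suc j) ^ unhit x j m \<tau> c) + (real n * K j) * coll j m \<tau>"
      unfolding sum.distrib by simp
    also have "\<dots> \<le> (\<Sum>c<n. \<rho> m j ^ unhit x j m \<tau> c - \<rho> m (Suc j) ^ unhit x j m \<tau> c) + 2 / \<theta> * coll j m \<tau>"
      using K_n[of j] j coll_nonneg by (intro add_left_mono mult_right_mono) auto
    finally show "K j * (\<Sum>v<n. \<Sum>c<n. gain x j m \<tau> c v) + L m \<tau> \<le> 0"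
      unfolding L_def sum_subtractf by linarith
  qed
  finally have drift: "(\<Sum>m=Suc j..<k. \<Sum>\<tau>\<in>good m. E m \<tau> * \<Delta> m \<tau>) \<le> 0" .
  have "\<Phi> x' (Suc j) = (\<Sum>m=Suc j..<k. \<Sum>\<tau>\<in>good m. E m \<tau> * exp (\<mu> * \<Delta> m \<tau>))"
    unfolding \<Phi>_def E_def \<Delta>_def by (simp flip: exp_add add: algebra_simps)
  also have "\<dots> \<le> (\<Sum>m=Suc j..<k. \<Sum>\<tau>\<in>good m. E m \<tau> * (1 + \<mu> * \<Delta> m \<tau> + 1 / real k))"
  proof (intro sum_mono mult_left_mono less_imp_le[OF E])
    fix m \<tau> assume "m \<in> {Suc j..<k}" "\<tau> \<in> good m"
    then have m: "j < m" "m < k" "\<tau> \<in> tuples" by (auto simp: good_def)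
    have "\<bar>\<Delta> m \<tau>\<bar> \<le> M" unfolding \<Delta>_def x'_def by (rule Y_Suc_abs[OF m \<pi>(1)])
    then have le: "\<bar>\<mu> * \<Delta> m \<tau>\<bar> \<le> \<mu> * M" using \<mu>_pos by (simp add: abs_mult)
    then have "exp (\<mu> * \<Delta> m \<tau>) \<le> 1 + \<mu> * \<Delta> m \<tau> + (\<mu> * \<Delta> m \<tau>)\<^sup>2"
      using \<mu>_M(2) by (intro exp_le_quadratic) linarith
    moreover have "(\<mu> * \<Delta> m \<tau>)\<^sup>2 \<le> (\<mu> * M)\<^sup>2"
      using le by (metis abs_ge_zero power2_abs power_mono)
    ultimately show "exp (\<mu> * \<Delta> m \<tau>) \<le> 1 + \<mu> * \<Delta> m \<tau> + 1 / real k" using \<mu>_M(1) by linarith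
  qed
  also have "\<dots> = (1 + 1 / real k) * (\<Sum>m=Suc j..<k. \<Sum>\<tau>\<in>good m. E m \<tau>) +
      \<mu> * (\<Sum>m=Suc j..<k. \<Sum>\<tau>\<in>good m. E m \<tau> * \<Delta> m \<tau>)"
    unfolding sum_distrib_left sum.distrib[symmetric] by (intro sum.cong refl) (simp add: algebra_simps)
  also have "\<dots> \<le> (1 + 1 / real k) * (\<Sum>m=Suc j..<k. \<Sum>\<tau>\<in>good m. E m \<tau>)"
    using drift \<mu>_pos by (simp add: mult_nonneg_nonpos)
  \<comment> \<open>The terms of part j, which has just been matched, are dropped.\<close>
  also have "\<dots> \<le> (1 + 1 / real k) * \<Phi> x j"
    unfolding \<Phi>_def E_def using E[unfolded E_def]
    by (intro mult_left_mono sum_mono2) (auto intro!: sum_nonneg)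
  finally show ?thesis using \<open>partial x' (Suc j)\<close> unfolding x'_def by blast
qed

lemma \<Phi>_0: "\<Phi> x 0 \<le> real k * real n ^ r * exp (\<mu> * (\<zeta> * real n))"
proof -
  have "\<Phi> x 0 \<le> (\<Sum>m=0..<k. \<Sum>\<tau>\<in>good m. exp (\<mu> * (\<zeta> * real n)))"
    unfolding \<Phi>_def
  proof (intro sum_mono)
    fix m \<tau> assume "\<tau> \<in> good m"
    moreover have "X x 0 m \<tau> = real n * \<rho> m 0 ^ r" by (simp add: X_def unhit_def hit_def)
    ultimately have "Y x 0 m \<tau> \<le> \<zeta> * real n" by (simp add: Y_def good_def)
    then show "exp (\<mu> * Y x 0 m \<tau>) \<le> exp (\<mu> * (\<zeta> * real n))" using \<mu>_pos by simp
  qed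
  also have "\<dots> = (\<Sum>m=0..<k. real (card (good m)) * exp (\<mu> * (\<zeta> * real n)))" by simp
  also have "\<dots> \<le> (\<Sum>m=0..<k. real n ^ r * exp (\<mu> * (\<zeta> * real n)))"
  proof (intro sum_mono mult_right_mono)
    fix m
    have "card (good m) \<le> card tuples"
      using finite_tuples by (intro card_mono) (auto simp: good_def)
    then show "real (card (good m)) \<le> real n ^ r" using card_tuples by linarith
  qed auto
  finally show ?thesis by simp
qed

text \<open>The growth (1 + 1/k)^j <= e <= 3 is the factor 3 in the hypothesis of
  \<open>extend_step\<close>.\<close>

lemma partial_exists: "j \<le> k \<Longrightarrow> \<exists>x. partial x j \<and>
    \<Phi> x j \<le> (1 + 1 / real k) ^ j * (real k * real n ^ r * exp (\<mu> * (\<zeta> * real n)))"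
proof (induction j)
  case 0
  show ?case using \<Phi>_0 by (intro exI[of _ "\<lambda>_ _. 0"]) (auto simp: partial_def)
next
  case (Suc j)
  define Z where "Z = real k * real n ^ r * exp (\<mu> * (\<zeta> * real n))"
  have Z: "0 \<le> Z" by (simp add: Z_def)
  obtain x where x: "partial x j" "\<Phi> x j \<le> (1 + 1 / real k) ^ j * Z"
    using Suc by (auto simp: Z_def)
  have "(1 + 1 / real k) ^ j \<le> (1 + 1 / real k) ^ k" using Suc by (intro power_increasing) auto
  also have "\<dots> \<le> exp (1 / real k) ^ k" by (intro power_mono) auto
  also have "\<dots> = exp 1" using k by (simp flip: exp_of_nat_mult)
  also have "\<dots> \<le> 3" by (rule exp_le)
  finally have "(1 + 1 / real k) ^ j * Z \<le> 3 * Z" using Z by (intro mult_right_mono)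
  then have "\<Phi> x j \<le> 3 * real k * real n ^ r * exp (\<mu> * (\<zeta> * real n))"
    using x by (simp add: Z_def)
  then obtain \<pi> where \<pi>: "partial (x(j := \<pi>)) (Suc j)" "\<Phi> (x(j := \<pi>)) (Suc j) \<le> (1 + 1 / real k) * \<Phi> x j"
    using extend_step[OF x(1)] Suc.prems by auto
  have "\<Phi> (x(j := \<pi>)) (Suc j) \<le> (1 + 1 / real k) * ((1 + 1 / real k) ^ j * Z)"
    using \<pi>(2) x(2) by (meson add_nonneg_nonneg divide_nonneg_nonneg mult_left_mono of_nat_0_le_iff order_trans zero_le_one)
  with \<pi>(1) show ?case by (auto simp: Z_def mult.assoc)
qed

lemma perfect_tiling: "\<exists>x. partial x k"
  using partial_exists[of k] by blast

end

section \<open>Few parts\<close>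

lemma decreasing_enumeration:
  fixes w :: "nat \<Rightarrow> real"
  assumes "finite R"
  shows "\<exists>e. bij_betw e {..<card R} R \<and> (\<forall>a b. a \<le> b \<longrightarrow> b < card R \<longrightarrow> w (e b) \<le> w (e a))"
proof -
  define l where "l = sort_key (\<lambda>u. - w u) (sorted_list_of_set R)"
  have l: "distinct l" "set l = R" "length l = card R" using assms by (simp_all add: l_def)
  have "sorted (map (\<lambda>u. - w u) l)" unfolding l_def by (rule sorted_sort_key)
  then have "w (l ! b) \<le> w (l ! a)" if "a \<le> b" "b < card R" for a b
    using sorted_nth_mono[of "map (\<lambda>u. - w u) l" a b] that l(3) by simp
  moreover have "bij_betw ((!) l) {..<card R} R" using bij_betw_nth[OF l(1)] l by auto
  ultimately show ?thesis by blast
qed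

lemma sum_initial_segment_ge:
  fixes a :: "nat \<Rightarrow> real"
  assumes anti: "\<And>i j. i \<le> j \<Longrightarrow> j < N \<Longrightarrow> a j \<le> a i" and L: "0 < L" "L \<le> N"
  shows "real L * (\<Sum>i<N. a i) \<le> real N * (\<Sum>i<L. a i)"
proof -
  define c where "c = a (L - 1)"
  have "(\<Sum>i<L. c) \<le> (\<Sum>i<L. a i)" using L by (intro sum_mono) (auto simp: c_def intro!: anti)
  then have 1: "real L * c \<le> (\<Sum>i<L. a i)" by simp
  have "(\<Sum>i=L..<N. a i) \<le> (\<Sum>i=L..<N. c)" using L by (intro sum_mono) (auto simp: c_def intro!: anti)
  then have 2: "(\<Sum>i=L..<N. a i) \<le> (real N - real L) * c" using L by (simp add: of_nat_diff)
  have "(\<Sum>i<N. a i) = (\<Sum>i<L. a i) + (\<Sum>i=L..<N. a i)"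
    using L sum.atLeastLessThan_concat[of 0 L N a] by (simp add: atLeast0LessThan)
  then have "real L * (\<Sum>i<N. a i) = real L * (\<Sum>i<L. a i) + real L * (\<Sum>i=L..<N. a i)"
    by (simp add: distrib_left)
  also have "\<dots> \<le> real L * (\<Sum>i<L. a i) + real L * ((real N - real L) * c)"
    using 2 by (intro add_left_mono mult_left_mono) auto
  also have "\<dots> = real L * (\<Sum>i<L. a i) + (real N - real L) * (real L * c)" by (simp add: algebra_simps)
  also have "\<dots> \<le> real L * (\<Sum>i<L. a i) + (real N - real L) * (\<Sum>i<L. a i)"
    using 1 L by (intro add_left_mono mult_left_mono) auto
  finally show ?thesis by (simp add: algebra_simps)
qed

text \<open>The first k D entries have at least the average of all N, and each block of D of them
  sums to at most D times its first entry.\<close>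

lemma sum_spaced_ge:
  fixes a :: "nat \<Rightarrow> real"
  assumes anti: "\<And>i j. i \<le> j \<Longrightarrow> j < N \<Longrightarrow> a j \<le> a i" and D: "0 < D" "k * D \<le> N" and k: "0 < k"
  shows "real k * (\<Sum>i<N. a i) \<le> real N * (\<Sum>p<k. a (p * D))"
proof -
  have "(\<Sum>i<k * D. a i) = (\<Sum>p<k. sum a {p * D..<p * D + D})" by (rule sum.nat_group[symmetric])
  also have "\<dots> \<le> (\<Sum>p<k. \<Sum>i\<in>{p * D..<p * D + D}. a (p * D))"
  proof (intro sum_mono anti)
    fix p i assume "p \<in> {..<k}" and i: "i \<in> {p * D..<p * D + D}"
    then have "Suc p * D \<le> k * D" by (intro mult_le_mono1) auto
    then show "p * D \<le> i" "i < N" using i D by auto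
  qed
  finally have 1: "(\<Sum>i<k * D. a i) \<le> real D * (\<Sum>p<k. a (p * D))" by (simp add: sum_distrib_left)
  have "real (k * D) * (\<Sum>i<N. a i) \<le> real N * (\<Sum>i<k * D. a i)"
    using D k by (intro sum_initial_segment_ge anti) auto
  also have "\<dots> \<le> real N * (real D * (\<Sum>p<k. a (p * D)))" using 1 by (intro mult_left_mono) auto
  finally have "real D * (real k * (\<Sum>i<N. a i)) \<le> real D * (real N * (\<Sum>p<k. a (p * D)))"
    by (simp add: mult.assoc mult.left_commute)
  then show ?thesis using D by (subst (asm) mult_le_cancel_left_pos) auto
qed

lemma bij_betw_shift_mod:
  fixes k :: nat
  assumes "0 < k"
  shows "bij_betw (\<lambda>s. (s + p) mod k) {..<k} {..<k}"
proof -
  have le: "s = t" if "s \<le> t" "t < k" "(s + p) mod k = (t + p) mod k" for s t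
  proof -
    have "k dvd t - s" using that mod_eq_dvd_iff_nat[of "s + p" "t + p" k] by simp
    then show ?thesis using that by (auto dest: dvd_imp_le)
  qed
  have "inj_on (\<lambda>s. (s + p) mod k) {..<k}"
    by (rule inj_onI) (metis le lessThan_iff nat_le_linear)
  moreover have "(\<lambda>s. (s + p) mod k) ` {..<k} \<subseteq> {..<k}" using assms by auto
  ultimately show ?thesis by (simp add: bij_betw_def endo_inj_surj)
qed

context conflict_system
begin

definition packing where
  "packing x (t::nat) \<longleftrightarrow>
    (\<forall>i<k. inj_on (x i) {..<t} \<and> x i ` {..<t} \<subseteq> {..<n}) \<and>
    (\<forall>i<k. \<forall>j<k. i \<noteq> j \<longrightarrow> (\<forall>c<t. \<not> Q i (x i c) j (x j c)))"

text \<open>Greedily choosing the heaviest admissible vertex, the part in position \<open>p\<close> gets one of its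
  \<open>p * D + 1\<close> heaviest vertices; averaging over the cyclic orders of the parts puts every part in
  every position once.\<close>

lemma heavy_transversal:
  fixes w :: "nat \<Rightarrow> nat \<Rightarrow> real"
  assumes k: "0 < k" and R: "\<And>j. j < k \<Longrightarrow> finite (R j) \<and> card (R j) = N"
    and D: "0 < D" "k * D \<le> N"
    and deg: "\<And>i j u. i < k \<Longrightarrow> j < k \<Longrightarrow> i \<noteq> j \<Longrightarrow> u \<in> R i \<Longrightarrow> card {v\<in>R j. Q i u j v} \<le> D"
  shows "\<exists>y. (\<forall>j<k. y j \<in> R j) \<and> (\<forall>i<k. \<forall>j<k. i \<noteq> j \<longrightarrow> \<not> Q i (y i) j (y j)) \<and>
    (\<Sum>j<k. \<Sum>u\<in>R j. w j u) \<le> real N * (\<Sum>j<k. w j (y j))"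
proof -
  have "\<forall>j. \<exists>e. j < k \<longrightarrow> bij_betw e {..<N} (R j) \<and>
      (\<forall>a b. a \<le> b \<longrightarrow> b < N \<longrightarrow> w j (e b) \<le> w j (e a))"
    using decreasing_enumeration R by metis
  then obtain e where e: "\<And>j. j < k \<Longrightarrow> bij_betw (e j) {..<N} (R j)"
    "\<And>j a b. j < k \<Longrightarrow> a \<le> b \<Longrightarrow> b < N \<Longrightarrow> w j (e j b) \<le> w j (e j a)"
    by metis
  \<comment> \<open>The weight guaranteed to part j in position p: counting from 0, its p D heaviest
    predecessors may all be excluded.\<close>
  define A where "A j p = w j (e j (p * D))" for j p
  have greedy: "\<exists>y. (\<forall>p<P. y ((p + s) mod k) \<in> R ((p + s) mod k) \<and>
        A ((p + s) mod k) p \<le> w ((p + s) mod k) (y ((p + s) mod k))) \<and>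
      (\<forall>p<P. \<forall>q<P. p \<noteq> q \<longrightarrow> \<not> Q ((p + s) mod k) (y ((p + s) mod k)) ((q + s) mod k) (y ((q + s) mod k)))"
    if "P \<le> k" for P s
    using that
  proof (induction P)
    case 0
    then show ?case by simp
  next
    case (Suc P)
    let ?\<sigma> = "\<lambda>p. (p + s) mod k"
    have inj: "inj_on ?\<sigma> {..<k}" using bij_betw_shift_mod[OF k] by (simp add: bij_betw_def)
    have \<sigma>k: "?\<sigma> p < k" for p using k by simp
    have \<sigma>P: "?\<sigma> p \<noteq> ?\<sigma> P" if "p < P" for p
      using inj_onD[OF inj, of p P] that Suc.prems by auto
    obtain y where y: "\<And>p. p < P \<Longrightarrow> y (?\<sigma> p) \<in> R (?\<sigma> p)"
      "\<And>p. p < P \<Longrightarrow> A (?\<sigma> p) p \<le> w (?\<sigma> p) (y (?\<sigma> p))"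
      "\<And>p q. p < P \<Longrightarrow> q < P \<Longrightarrow> p \<noteq> q \<Longrightarrow> \<not> Q (?\<sigma> p) (y (?\<sigma> p)) (?\<sigma> q) (y (?\<sigma> q))"
      using Suc by auto
    let ?j = "?\<sigma> P"
    \<comment> \<open>The vertices excluded by the P earlier choices, at most P D of them; one of
      the P D + 1 heaviest survives.\<close>
    define F where "F = (\<Union>p<P. {v\<in>R ?j. Q (?\<sigma> p) (y (?\<sigma> p)) ?j v})"
    have "card F \<le> (\<Sum>p<P. card {v\<in>R ?j. Q (?\<sigma> p) (y (?\<sigma> p)) ?j v})"
      unfolding F_def by (intro card_UN_le) auto
    also have "\<dots> \<le> (\<Sum>p<P. D)" using y(1) \<sigma>P \<sigma>k by (intro sum_mono deg) auto
    finally have cF: "card F \<le> P * D" by simp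
    have finF: "finite F" unfolding F_def using R \<sigma>k by auto
    have "Suc P * D \<le> k * D" using Suc.prems by (intro mult_le_mono1)
    then have PD: "P * D < N" using D by simp
    have ej: "inj_on (e ?j) {..<N}" "e ?j ` {..<N} = R ?j" using e(1)[OF \<sigma>k] by (auto simp: bij_betw_def)
    have "{..P * D} \<subseteq> {..<N}" using PD by auto
    then have card_e: "card (e ?j ` {..P * D}) = Suc (P * D)"
      using inj_on_subset[OF ej(1)] by (subst card_image) auto
    have "\<not> e ?j ` {..P * D} \<subseteq> F"
    proof
      assume "e ?j ` {..P * D} \<subseteq> F"
      from card_mono[OF finF this] show False using cF card_e by linarith
    qed
    then obtain t where t: "t \<le> P * D" "e ?j t \<notin> F" by auto
    let ?z = "e ?j t"
    have z: "?z \<in> R ?j" using t PD ej(2) by auto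
    have Az: "A ?j P \<le> w ?j ?z" unfolding A_def using t PD \<sigma>k by (intro e(2)) auto
    have Qz: "\<not> Q (?\<sigma> p) (y (?\<sigma> p)) ?j ?z" if "p < P" for p
      using t(2) z that unfolding F_def by blast
    define y' where "y' = y(?j := ?z)"
    have y': "y' ?j = ?z" "\<And>p. p < P \<Longrightarrow> y' (?\<sigma> p) = y (?\<sigma> p)"
      using \<sigma>P by (auto simp: y'_def)
    show ?case
    proof (intro exI[of _ y'] conjI allI impI)
      fix p assume "p < Suc P"
      then consider "p < P" | "p = P" by linarith
      then show "y' (?\<sigma> p) \<in> R (?\<sigma> p)" "A (?\<sigma> p) p \<le> w (?\<sigma> p) (y' (?\<sigma> p))"
        using y(1,2) y' z Az by (cases; simp)+
    next
      fix p q assume "p < Suc P" "q < Suc P" "p \<noteq> q"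
      then consider "p < P" "q < P" | "p < P" "q = P" | "p = P" "q < P" by linarith
      then show "\<not> Q (?\<sigma> p) (y' (?\<sigma> p)) (?\<sigma> q) (y' (?\<sigma> q))"
      proof cases
        case 1
        then show ?thesis using y(3) y' \<open>p \<noteq> q\<close> by simp
      next
        case 2
        then show ?thesis using Qz y' by simp
      next
        case 3
        then show ?thesis using Qz[of q] y' Q_sym by metis
      qed
    qed
  qed
  have "\<exists>y. \<forall>s. (\<forall>p<k. y s ((p + s) mod k) \<in> R ((p + s) mod k) \<and>
        A ((p + s) mod k) p \<le> w ((p + s) mod k) (y s ((p + s) mod k))) \<and>
      (\<forall>p<k. \<forall>q<k. p \<noteq> q \<longrightarrow>
        \<not> Q ((p + s) mod k) (y s ((p + s) mod k)) ((q + s) mod k) (y s ((q + s) mod k)))"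
    using greedy[OF order_refl] by (intro choice allI)
  then obtain y where yR: "\<And>s p. p < k \<Longrightarrow> y s ((p + s) mod k) \<in> R ((p + s) mod k)"
    and yA: "\<And>s p. p < k \<Longrightarrow> A ((p + s) mod k) p \<le> w ((p + s) mod k) (y s ((p + s) mod k))"
    and yQ: "\<And>s p q. p < k \<Longrightarrow> q < k \<Longrightarrow> p \<noteq> q \<Longrightarrow>
      \<not> Q ((p + s) mod k) (y s ((p + s) mod k)) ((q + s) mod k) (y s ((q + s) mod k))"
    by blast
  have surj: "\<exists>p<k. j = (p + s) mod k" if "j < k" for j s
  proof -
    have "j \<in> (\<lambda>p. (p + s) mod k) ` {..<k}"
      using bij_betw_imp_surj_on[OF bij_betw_shift_mod[OF k, of s]] that by simp
    then show ?thesis by auto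
  qed
  have "real k * (\<Sum>j<k. \<Sum>u\<in>R j. w j u) = (\<Sum>j<k. real k * (\<Sum>i<N. w j (e j i)))"
    unfolding sum_distrib_left[symmetric]
    by (intro arg_cong2[of _ _ _ _ "(*)"] sum.cong refl sum.reindex_bij_betw[OF e(1), symmetric]) auto
  also have "\<dots> \<le> (\<Sum>j<k. real N * (\<Sum>p<k. A j p))"
    unfolding A_def using D k e(2) by (intro sum_mono sum_spaced_ge) auto
  also have "\<dots> = real N * (\<Sum>p<k. \<Sum>j<k. A j p)"
    by (subst sum.swap) (simp add: sum_distrib_left)
  also have "(\<Sum>p<k. \<Sum>j<k. A j p) = (\<Sum>p<k. \<Sum>s<k. A ((p + s) mod k) p)"
  proof (rule sum.cong[OF refl])
    fix p
    show "(\<Sum>j<k. A j p) = (\<Sum>s<k. A ((p + s) mod k) p)"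
      using sum.reindex_bij_betw[OF bij_betw_shift_mod[OF k, of p], where g = "\<lambda>j. A j p"]
      by (simp add: add.commute)
  qed
  also have "\<dots> \<le> (\<Sum>p<k. \<Sum>s<k. w ((p + s) mod k) (y s ((p + s) mod k)))"
    using yA by (intro sum_mono) auto
  also have "\<dots> = (\<Sum>s<k. \<Sum>p<k. w ((p + s) mod k) (y s ((p + s) mod k)))" by (rule sum.swap)
  also have "\<dots> = (\<Sum>s<k. \<Sum>j<k. w j (y s j))"
    by (rule sum.cong[OF refl]) (rule sum.reindex_bij_betw[OF bij_betw_shift_mod[OF k]])
  finally have avg: "real k * (\<Sum>j<k. \<Sum>u\<in>R j. w j u) \<le> real N * (\<Sum>s<k. \<Sum>j<k. w j (y s j))"
    by (simp add: mult_left_mono)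
  have "\<exists>s<k. (\<Sum>j<k. \<Sum>u\<in>R j. w j u) \<le> real N * (\<Sum>j<k. w j (y s j))"
  proof (rule ccontr)
    assume "\<not> ?thesis"
    then have "(\<Sum>s<k. real N * (\<Sum>j<k. w j (y s j))) < (\<Sum>s<k. (\<Sum>j<k. \<Sum>u\<in>R j. w j u))"
      using k by (intro sum_strict_mono) auto
    with avg show False by (simp add: sum_distrib_left)
  qed
  then obtain s where s: "(\<Sum>j<k. \<Sum>u\<in>R j. w j u) \<le> real N * (\<Sum>j<k. w j (y s j))" by blast
  have "y s j \<in> R j" if "j < k" for j using surj[OF that, of s] yR[of _ s] by auto
  moreover have "\<not> Q i (y s i) j (y s j)" if "i < k" "j < k" "i \<noteq> j" for i j
    using surj[OF that(1), of s] surj[OF that(2), of s] that(3) yQ[of _ _ s] by auto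
  ultimately show ?thesis using s by blast
qed

end

text \<open>\<open>par1\<close> lets half of the slack \<delta> absorb the logarithm of the bound on
  the number of terms of the potential; \<open>par2\<close> leaves at least 4 k vertices per part
  until the end.\<close>

locale few_parts = conflict_system +
  fixes \<epsilon> \<delta> :: real
  assumes \<epsilon>: "0 < \<epsilon>" "\<epsilon> < 1" and \<delta>: "0 < \<delta>" "\<delta> < 1" and k: "0 < k"
    and d_le: "real k * real d \<le> (1 - \<delta>) * real n"
    and par1: "ln (3 * (real k)\<^sup>2 * real n) \<le> \<epsilon> * \<delta> * sqrt (real n) / (4 * real k)"
    and par2: "4 * real k \<le> \<epsilon> * real n"
begin

definition rem where "rem x t j = {..<n} - x j ` {..<t::nat}"
definition cnt where "cnt x t i v j = card {u\<in>rem x t j. Q i v j u}"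
text \<open>One removal changes a ratio by at most 1/(N - 1) <= 2/(\<epsilon> n), where N vertices
  per part remain. This \<mu> makes the exponent change by at most n^(-1/2), so the quadratic error
  is 1/n per step.\<close>

definition \<mu> where "\<mu> = \<epsilon> * sqrt (real n) / 2"
text \<open>The vertex v runs over removed vertices as well: the index set stays fixed and
  consecutive potentials are compared term by term.\<close>

definition pot where "pot x t = (\<Sum>i<k. \<Sum>j\<in>{..<k} - {i}. \<Sum>v<n.
  exp (\<mu> * (real (cnt x t i v j) / real (n - t))))"

lemma n_pos: "0 < n"
  using par2 \<epsilon> k by (cases n) auto

lemma \<mu>_pos: "0 < \<mu>"
  unfolding \<mu>_def using \<epsilon> n_pos by simp

lemma card_rem: "packing x t \<Longrightarrow> j < k \<Longrightarrow> card (rem x t j) = n - t"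
  unfolding rem_def packing_def by (subst card_Diff_subset) (auto simp: card_image)

text \<open>A single exponential is at most the whole potential. Taking logarithms,
  \<open>par1\<close> bounds ln (3 k^2 n) by \<mu> \<delta>/(2 k), which turns 1 - \<delta> into 1 -
  \<delta>/2.\<close>

lemma cnt_le_d:
  assumes pot: "pot x t \<le> 3 * ((real k)\<^sup>2 * real n * exp (\<mu> * ((1 - \<delta>) / real k)))"
    and ij: "i < k" "j < k" "i \<noteq> j" "v < n" and t: "t < n"
  shows "real (cnt x t i v j) \<le> real (n - t) * ((1 - \<delta> / 2) / real k)"
proof -
  have "exp (\<mu> * (real (cnt x t i v j) / real (n - t))) \<le>
      (\<Sum>v<n. exp (\<mu> * (real (cnt x t i v j) / real (n - t))))"
    using ij by (intro member_le_sum[of v "{..<n}" "\<lambda>v. exp (\<mu> * (real (cnt x t i v j) / real (n - t)))"]) auto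
  also have "\<dots> \<le> (\<Sum>j\<in>{..<k} - {i}. \<Sum>v<n. exp (\<mu> * (real (cnt x t i v j) / real (n - t))))"
    using ij by (intro member_le_sum[of j "{..<k} - {i}" "\<lambda>j. \<Sum>v<n. exp (\<mu> * (real (cnt x t i v j) / real (n - t)))"]) (auto intro!: sum_nonneg)
  also have "\<dots> \<le> pot x t"
    unfolding pot_def using ij by (intro member_le_sum[of i "{..<k}" "\<lambda>i. \<Sum>j\<in>{..<k} - {i}. \<Sum>v<n. exp (\<mu> * (real (cnt x t i v j) / real (n - t)))"]) (auto intro!: sum_nonneg)
  also have "\<dots> \<le> 3 * (real k)\<^sup>2 * real n * exp (\<mu> * ((1 - \<delta>) / real k))" using pot by simp
  also have "\<dots> = exp (ln (3 * (real k)\<^sup>2 * real n) + \<mu> * ((1 - \<delta>) / real k))"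
    using k n_pos by (simp add: exp_add)
  finally have "\<mu> * (real (cnt x t i v j) / real (n - t)) \<le>
      ln (3 * (real k)\<^sup>2 * real n) + \<mu> * ((1 - \<delta>) / real k)" by simp
  also have "\<dots> \<le> \<mu> * (\<delta> / (2 * real k)) + \<mu> * ((1 - \<delta>) / real k)"
    using par1 by (simp add: \<mu>_def field_simps)
  also have "\<dots> = \<mu> * ((1 - \<delta> / 2) / real k)" using k by (simp add: field_simps)
  finally have "real (cnt x t i v j) / real (n - t) \<le> (1 - \<delta> / 2) / real k"
    using \<mu>_pos by (simp only: mult_le_cancel_left_pos)
  then show ?thesis using t by (simp add: divide_le_eq mult.commute)
qed

lemma pot_0: "pot x 0 \<le> (real k)\<^sup>2 * real n * exp (\<mu> * ((1 - \<delta>) / real k))"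
proof -
  have "pot x 0 \<le> (\<Sum>i<k. \<Sum>j\<in>{..<k} - {i}. \<Sum>v<n. exp (\<mu> * ((1 - \<delta>) / real k)))"
    unfolding pot_def
  proof (intro sum_mono)
    fix i j v assume i: "i \<in> {..<k}" and j: "j \<in> {..<k} - {i}" and v: "v \<in> {..<n}"
    have "cnt x 0 i v j \<le> d" using i j v Q_deg[of i j v] by (auto simp: cnt_def rem_def)
    then have "real k * real (cnt x 0 i v j) \<le> real k * real d" by (intro mult_left_mono) auto
    also have "\<dots> \<le> (1 - \<delta>) * real n" by (rule d_le)
    finally have "real (cnt x 0 i v j) / real (n - 0) \<le> (1 - \<delta>) / real k"
      using k n_pos by (simp add: field_simps)
    then show "exp (\<mu> * (real (cnt x 0 i v j) / real (n - 0))) \<le> exp (\<mu> * ((1 - \<delta>) / real k))"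
      unfolding exp_le_cancel_iff using \<mu>_pos by (intro mult_left_mono) auto
  qed
  also have "\<dots> \<le> (\<Sum>i<k. \<Sum>j<k. \<Sum>v<n. exp (\<mu> * ((1 - \<delta>) / real k)))"
    by (intro sum_mono sum_mono2) auto
  finally show ?thesis by (simp add: power2_eq_square)
qed

text \<open>The bound on the potential keeps conflict degrees below N/k, so that a greedy clique
  exists; choosing it of at least average weight makes the first-order change of the potential
  nonpositive.\<close>

lemma remove_step:
  assumes x: "packing x t" and t: "\<epsilon> * real n \<le> real n - real t"
    and pot: "pot x t \<le> 3 * ((real k)\<^sup>2 * real n * exp (\<mu> * ((1 - \<delta>) / real k)))"
  shows "\<exists>y. packing (\<lambda>i. (x i)(t := y i)) (Suc t) \<and>
    pot (\<lambda>i. (x i)(t := y i)) (Suc t) \<le> (1 + 1 / real n) * pot x t"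
proof -
  have \<epsilon>n: "4 \<le> \<epsilon> * real n" using par2 k by linarith
  have tn: "t < n" using t \<epsilon>n by linarith
  define N where "N = n - t"
  have N: "real N = real n - real t" using tn by (simp add: N_def)
  have N4: "4 \<le> real N" "\<epsilon> * real n \<le> real N" using t \<epsilon>n N by auto
  define D where "D = nat \<lfloor>real N * ((1 - \<delta> / 2) / real k)\<rfloor>"
  define E where "E i j v = exp (\<mu> * (real (cnt x t i v j) / real N))" for i j v
  have E: "0 < E i j v" for i j v by (simp add: E_def)
  \<comment> \<open>The exponential weight of all conflict counts that drop when u leaves part j.
    Weight at least the average means that conflicts disappear at least in proportion to the
    shrinking parts.\<close>
  define w where "w j u = (\<Sum>i\<in>{..<k} - {j}. \<Sum>v<n. E i j v * of_bool (Q i v j u))" for j u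
  have finrem: "finite (rem x t j)" for j by (simp add: rem_def)
  have "\<exists>y. (\<forall>j<k. y j \<in> rem x t j) \<and> (\<forall>i<k. \<forall>j<k. i \<noteq> j \<longrightarrow> \<not> Q i (y i) j (y j)) \<and>
    (\<Sum>j<k. \<Sum>u\<in>rem x t j. w j u) \<le> real N * (\<Sum>j<k. w j (y j))"
  proof (rule heavy_transversal[OF k])
    show "finite (rem x t j) \<and> card (rem x t j) = N" if "j < k" for j
      using card_rem[OF x that] finrem by (simp add: N_def)
    have "1 * 1 \<le> (real N / real k) * (1 - \<delta> / 2) * 1"
    proof -
      have "2 * real k \<le> real N" using par2 N4 k by linarith
      then have "2 \<le> real N / real k" using k by (simp add: field_simps)
      then have "2 * (1 / 2) \<le> (real N / real k) * (1 - \<delta> / 2)" using \<delta> by (intro mult_mono) auto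
      then show ?thesis by simp
    qed
    then have "1 \<le> real N * ((1 - \<delta> / 2) / real k)" by simp
    then show "0 < D" unfolding D_def by linarith
    have "0 \<le> real N * ((1 - \<delta> / 2) / real k)" using \<delta> by simp
    then have "real D \<le> real N * ((1 - \<delta> / 2) / real k)" unfolding D_def by (rule of_nat_floor)
    also have "\<dots> \<le> real N * (1 / real k)"
      using \<delta> by (intro mult_left_mono divide_right_mono) auto
    finally have "real (k * D) \<le> real N" using k by (simp add: field_simps)
    then show "k * D \<le> N" by (simp only: of_nat_le_iff)
    show "card {v \<in> rem x t j. Q i u j v} \<le> D" if "i < k" "j < k" "i \<noteq> j" "u \<in> rem x t i" for i j u
    proof -
      have "real (cnt x t i u j) \<le> real N * ((1 - \<delta> / 2) / real k)"
        unfolding N_def using that by (intro cnt_le_d[OF pot] tn) (auto simp: rem_def)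
      then show ?thesis unfolding D_def cnt_def by (simp add: le_nat_floor)
    qed
  qed
  then obtain y where yR: "\<And>j. j < k \<Longrightarrow> y j \<in> rem x t j"
    and yQ: "\<And>i j. i < k \<Longrightarrow> j < k \<Longrightarrow> i \<noteq> j \<Longrightarrow> \<not> Q i (y i) j (y j)"
    and yw: "(\<Sum>j<k. \<Sum>u\<in>rem x t j. w j u) \<le> real N * (\<Sum>j<k. w j (y j))" by blast
  define x' where "x' = (\<lambda>i. (x i)(t := y i))"
  have x't: "x' i ` {..<Suc t} = insert (y i) (x i ` {..<t})" for i
    unfolding x'_def lessThan_Suc by auto
  have "packing x' (Suc t)"
    unfolding packing_def
  proof (intro conjI allI impI)
    fix i assume i: "i < k"
    have "inj_on (x i) {..<t}" "y i \<notin> x i ` {..<t}" using x yR[OF i] i by (auto simp: packing_def rem_def)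
    then show "inj_on (x' i) {..<Suc t}"
      unfolding x'_def lessThan_Suc by (auto simp: inj_on_def image_iff; metis lessThan_iff)
    show "x' i ` {..<Suc t} \<subseteq> {..<n}" using x yR[OF i] i unfolding x't by (auto simp: packing_def rem_def)
  next
    fix i j c assume "i < k" "j < k" "i \<noteq> j" "c < Suc t"
    then show "\<not> Q i (x' i c) j (x' j c)"
      using x yQ[of i j] by (auto simp: packing_def x'_def less_Suc_eq)
  qed
  have rem': "rem x' (Suc t) j = rem x t j - {y j}" for j
    unfolding rem_def x't by auto
  have cnt': "real (cnt x' (Suc t) i v j) = real (cnt x t i v j) - of_bool (Q i v j (y j))"
    if "j < k" for i v j
  proof -
    have eq: "{u\<in>rem x' (Suc t) j. Q i v j u} = {u\<in>rem x t j. Q i v j u} - {y j}"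
      unfolding rem' by auto
    show ?thesis
    proof (cases "Q i v j (y j)")
      case True
      then have "y j \<in> {u\<in>rem x t j. Q i v j u}" using yR[OF that] by simp
      moreover from this have "0 < card {u\<in>rem x t j. Q i v j u}"
        using finrem[of j] by (auto simp: card_gt_0_iff)
      ultimately show ?thesis using True unfolding cnt_def eq by (simp add: of_nat_diff)
    next
      case False
      then have "y j \<notin> {u\<in>rem x t j. Q i v j u}" by simp
      then show ?thesis using False unfolding cnt_def eq by simp
    qed
  qed
  \<comment> \<open>The change of a ratio c/N when one vertex is removed, by the identity (c - b)/(N
    - 1) = c/N + (c/N - b)/(N - 1).\<close>
  define \<Delta> where "\<Delta> i j v = (real (cnt x t i v j) / real N - of_bool (Q i v j (y j))) / (real N - 1)" for i j v
  have ratio: "real (cnt x' (Suc t) i v j) / real (n - Suc t) = real (cnt x t i v j) / real N + \<Delta> i j v"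
    if "j < k" for i j v
  proof -
    have eq: "(c - b) / (z - 1) = c / z + (c / z - b) / (z - 1)" if "4 \<le> z" for c b z :: real
      using that by (simp add: field_simps)
    have "real (n - Suc t) = real N - 1" using tn N by simp
    then show ?thesis unfolding \<Delta>_def cnt'[OF that] using eq[OF N4(1)] by metis
  qed
  have \<Delta>_le: "\<bar>\<mu> * \<Delta> i j v\<bar> \<le> 1 / sqrt (real n)" if "j < k" for i j v
  proof -
    have "cnt x t i v j \<le> card (rem x t j)" unfolding cnt_def using finrem by (intro card_mono) auto
    then have "0 \<le> real (cnt x t i v j) / real N" "real (cnt x t i v j) / real N \<le> 1"
      using card_rem[OF x that] by (auto simp: N_def divide_le_eq_1)
    then have "\<bar>real (cnt x t i v j) / real N - of_bool (Q i v j (y j))\<bar> \<le> 1"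
      by (cases "Q i v j (y j)") auto
    then have "\<bar>\<Delta> i j v\<bar> \<le> 1 / (real N - 1)"
      unfolding \<Delta>_def abs_divide using N4 by (simp add: divide_right_mono)
    also have "\<dots> \<le> 1 / (\<epsilon> * real n / 2)" using N4 \<epsilon>n by (intro divide_left_mono) auto
    finally have "\<mu> * \<bar>\<Delta> i j v\<bar> \<le> \<mu> * (1 / (\<epsilon> * real n / 2))" using \<mu>_pos by (intro mult_left_mono) auto
    also have "\<dots> = sqrt (real n) / real n" unfolding \<mu>_def using \<epsilon> by simp
    also have "\<dots> = 1 / sqrt (real n)" using n_pos real_div_sqrt[of "real n"] by (simp add: field_simps)
    finally show ?thesis using \<mu>_pos by (simp add: abs_mult)
  qed
  have swap: "(\<Sum>j<k. \<Sum>i\<in>{..<k} - {j}. f i j) = (\<Sum>i<k. \<Sum>j\<in>{..<k} - {i}. f i j)" for f :: "nat \<Rightarrow> nat \<Rightarrow> real"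
  proof -
    have "(\<Sum>j<k. \<Sum>i\<in>{..<k} - {j}. f i j) = (\<Sum>j<k. \<Sum>i<k. if i = j then 0 else f i j)"
      by (intro sum.cong refl sum.mono_neutral_cong_left) auto
    also have "\<dots> = (\<Sum>i<k. \<Sum>j<k. if i = j then 0 else f i j)" by (rule sum.swap)
    also have "\<dots> = (\<Sum>i<k. \<Sum>j\<in>{..<k} - {i}. f i j)"
      by (intro sum.cong refl sum.mono_neutral_cong_right) auto
    finally show ?thesis .
  qed
  have sumw: "(\<Sum>j<k. \<Sum>u\<in>rem x t j. w j u) =
      (\<Sum>i<k. \<Sum>j\<in>{..<k} - {i}. \<Sum>v<n. E i j v * real (cnt x t i v j))"
  proof -
    have "(\<Sum>u\<in>rem x t j. w j u) = (\<Sum>i\<in>{..<k} - {j}. \<Sum>v<n. E i j v * real (cnt x t i v j))" for j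
    proof -
      have "(\<Sum>u\<in>rem x t j. w j u) = (\<Sum>i\<in>{..<k} - {j}. \<Sum>u\<in>rem x t j. \<Sum>v<n. E i j v * of_bool (Q i v j u))"
        unfolding w_def by (rule sum.swap)
      also have "\<dots> = (\<Sum>i\<in>{..<k} - {j}. \<Sum>v<n. \<Sum>u\<in>rem x t j. E i j v * of_bool (Q i v j u))"
        by (intro sum.cong refl sum.swap)
      finally show ?thesis
        unfolding cnt_def real_card_filter[OF finrem] by (simp only: sum_distrib_left)
    qed
    then show ?thesis using swap by simp
  qed
  have drift: "(\<Sum>i<k. \<Sum>j\<in>{..<k} - {i}. \<Sum>v<n. E i j v * \<Delta> i j v) \<le> 0"
  proof -
    have "(\<Sum>i<k. \<Sum>j\<in>{..<k} - {i}. \<Sum>v<n. E i j v * \<Delta> i j v) =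
      ((\<Sum>i<k. \<Sum>j\<in>{..<k} - {i}. \<Sum>v<n. E i j v * real (cnt x t i v j)) / real N -
       (\<Sum>i<k. \<Sum>j\<in>{..<k} - {i}. \<Sum>v<n. E i j v * of_bool (Q i v j (y j)))) / (real N - 1)"
      unfolding \<Delta>_def sum_divide_distrib sum_subtractf[symmetric]
      by (intro sum.cong refl) (simp add: algebra_simps)
    also have "(\<Sum>i<k. \<Sum>j\<in>{..<k} - {i}. \<Sum>v<n. E i j v * of_bool (Q i v j (y j))) = (\<Sum>j<k. w j (y j))"
      unfolding w_def by (rule swap[symmetric])
    also have "(\<Sum>i<k. \<Sum>j\<in>{..<k} - {i}. \<Sum>v<n. E i j v * real (cnt x t i v j)) / real N \<le> (\<Sum>j<k. w j (y j))"
      using yw N4 unfolding sumw by (simp add: divide_le_eq mult.commute)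
    finally show ?thesis using N4 by (simp add: divide_nonpos_pos divide_right_mono)
  qed
  have "pot x' (Suc t) = (\<Sum>i<k. \<Sum>j\<in>{..<k} - {i}. \<Sum>v<n. E i j v * exp (\<mu> * \<Delta> i j v))"
    unfolding pot_def E_def
    by (intro sum.cong refl) (auto simp: ratio distrib_left exp_add)
  also have "\<dots> \<le> (\<Sum>i<k. \<Sum>j\<in>{..<k} - {i}. \<Sum>v<n. E i j v * (1 + \<mu> * \<Delta> i j v + 1 / real n))"
  proof (intro sum_mono mult_left_mono less_imp_le[OF E])
    fix i j v assume "j \<in> {..<k} - {i}"
    then have le: "\<bar>\<mu> * \<Delta> i j v\<bar> \<le> 1 / sqrt (real n)" by (intro \<Delta>_le) auto
    also have "\<dots> \<le> 1" using n_pos by simp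
    finally have "exp (\<mu> * \<Delta> i j v) \<le> 1 + \<mu> * \<Delta> i j v + (\<mu> * \<Delta> i j v)\<^sup>2" by (rule exp_le_quadratic)
    moreover have "(\<mu> * \<Delta> i j v)\<^sup>2 \<le> (1 / sqrt (real n))\<^sup>2"
      using le by (metis abs_ge_zero power2_abs power_mono)
    moreover have "(1 / sqrt (real n))\<^sup>2 = 1 / real n" by (simp add: power_divide)
    ultimately show "exp (\<mu> * \<Delta> i j v) \<le> 1 + \<mu> * \<Delta> i j v + 1 / real n" by linarith
  qed
  also have "\<dots> = (1 + 1 / real n) * (\<Sum>i<k. \<Sum>j\<in>{..<k} - {i}. \<Sum>v<n. E i j v) +
      \<mu> * (\<Sum>i<k. \<Sum>j\<in>{..<k} - {i}. \<Sum>v<n. E i j v * \<Delta> i j v)"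
    unfolding sum_distrib_left sum.distrib[symmetric] by (intro sum.cong refl) (simp add: algebra_simps)
  also have "\<dots> \<le> (1 + 1 / real n) * (\<Sum>i<k. \<Sum>j\<in>{..<k} - {i}. \<Sum>v<n. E i j v)"
    using drift \<mu>_pos by (simp add: mult_nonneg_nonpos)
  also have "\<dots> = (1 + 1 / real n) * pot x t" by (simp add: pot_def E_def N_def)
  finally show ?thesis using \<open>packing x' (Suc t)\<close> unfolding x'_def by blast
qed

text \<open>The + 1 lets t reach the rounded-up target, while before each removal every part still
  has at least \<epsilon> n vertices.\<close>

lemma packing_exists:
  "real t < (1 - \<epsilon>) * real n + 1 \<Longrightarrow> \<exists>x. packing x t \<and>
    pot x t \<le> (1 + 1 / real n) ^ t * ((real k)\<^sup>2 * real n * exp (\<mu> * ((1 - \<delta>) / real k)))"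
proof (induction t)
  case 0
  show ?case using pot_0 by (intro exI[of _ "\<lambda>_ _. 0"]) (auto simp: packing_def)
next
  case (Suc t)
  define Z where "Z = (real k)\<^sup>2 * real n * exp (\<mu> * ((1 - \<delta>) / real k))"
  have Z: "0 \<le> Z" by (simp add: Z_def)
  obtain x where x: "packing x t" "pot x t \<le> (1 + 1 / real n) ^ t * Z"
    using Suc by (auto simp: Z_def)
  have t: "\<epsilon> * real n \<le> real n - real t" using Suc.prems by (simp add: algebra_simps)
  moreover have "0 \<le> \<epsilon> * real n" using \<epsilon> by simp
  ultimately have "t \<le> n" by linarith
  then have "(1 + 1 / real n) ^ t \<le> (1 + 1 / real n) ^ n" by (intro power_increasing) auto
  also have "\<dots> \<le> exp (1 / real n) ^ n" by (intro power_mono) auto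
  also have "\<dots> = exp 1" using n_pos by (simp flip: exp_of_nat_mult)
  also have "\<dots> \<le> 3" by (rule exp_le)
  finally have "(1 + 1 / real n) ^ t * Z \<le> 3 * Z" using Z by (intro mult_right_mono)
  then obtain y where y: "packing (\<lambda>i. (x i)(t := y i)) (Suc t)"
    "pot (\<lambda>i. (x i)(t := y i)) (Suc t) \<le> (1 + 1 / real n) * pot x t"
    using remove_step[OF x(1) t] x(2) by (auto simp: Z_def)
  have "pot (\<lambda>i. (x i)(t := y i)) (Suc t) \<le> (1 + 1 / real n) * ((1 + 1 / real n) ^ t * Z)"
    using y(2) x(2) by (meson add_nonneg_nonneg divide_nonneg_nonneg mult_left_mono of_nat_0_le_iff order_trans zero_le_one)
  with y(1) show ?case by (auto simp: Z_def mult.assoc)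
qed

lemma almost_perfect_tiling: "\<exists>x t. packing x t \<and> (1 - \<epsilon>) * real n \<le> real t"
proof -
  have "0 \<le> (1 - \<epsilon>) * real n" using \<epsilon> by simp
  then have "real (nat \<lceil>(1 - \<epsilon>) * real n\<rceil>) < (1 - \<epsilon>) * real n + 1" by linarith
  then obtain x where "packing x (nat \<lceil>(1 - \<epsilon>) * real n\<rceil>)" using packing_exists by blast
  moreover have "(1 - \<epsilon>) * real n \<le> real (nat \<lceil>(1 - \<epsilon>) * real n\<rceil>)" by linarith
  ultimately show ?thesis by blast
qed

end

section \<open>Tilings\<close>

text \<open>The constants are chosen in turn: r by geometric growth, \<zeta> at half of what the
  strict inequality allows, and then \<open>k\<^sub>0\<close>, because sqrt k in the exponent beats
  the factor k.\<close>

lemma many_parts_parameters: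
  fixes \<theta> :: real
  assumes \<theta>: "0 < \<theta>" "\<theta> < 1"
  shows "\<exists>r \<zeta> k\<^sub>0. 0 < r \<and> 0 < \<zeta> \<and> 2 \<le> \<theta> * (1 + \<theta>\<^sup>2 / 2) ^ r \<and>
    8 * \<zeta> < \<theta> * \<theta> ^ r * (\<theta>\<^sup>2 / 2) ^ r \<and>
    (\<forall>k\<ge>k\<^sub>0. 3 * real k * exp (- (\<zeta> * \<theta> * sqrt (real k) / (4 * (real r)\<^sup>2))) \<le> \<zeta> \<and>
      2 / \<theta> * (real r)\<^sup>2 / (\<zeta> * real k) \<le> \<zeta>)"
proof -
  obtain r where r': "2 / \<theta> < (1 + \<theta>\<^sup>2 / 2) ^ r"
    using real_arch_pow[of "1 + \<theta>\<^sup>2 / 2" "2 / \<theta>"] \<theta> by auto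
  then have r2: "2 \<le> \<theta> * (1 + \<theta>\<^sup>2 / 2) ^ r" using \<theta> by (simp add: field_simps)
  have r: "0 < r" using r2 \<theta> by (cases r) auto
  define \<zeta> where "\<zeta> = \<theta> * \<theta> ^ r * (\<theta>\<^sup>2 / 2) ^ r / 16"
  have \<zeta>: "0 < \<zeta>" using \<theta> by (simp add: \<zeta>_def)
  define c where "c = \<zeta> * \<theta> / (4 * (real r)\<^sup>2)"
  have c: "0 < c" using \<zeta> \<theta> r by (simp add: c_def)
  have "((\<lambda>x. 3 * x * exp (- (c * sqrt x))) \<longlongrightarrow> 0) at_top" using c by real_asymp
  then have "\<forall>\<^sub>F x in at_top. 3 * x * exp (- (c * sqrt x)) < \<zeta>"
    using \<zeta> by (rule order_tendstoD)
  then have 1: "\<forall>\<^sub>F k in sequentially. 3 * real k * exp (- (c * sqrt (real k))) < \<zeta>"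
    using eventually_compose_filterlim filterlim_real_sequentially by blast
  define b where "b = 2 / \<theta> * (real r)\<^sup>2 / \<zeta>"
  have "((\<lambda>x::real. b / x) \<longlongrightarrow> 0) at_top" by real_asymp
  then have "\<forall>\<^sub>F x in at_top. b / x < \<zeta>"
    using \<zeta> by (rule order_tendstoD)
  then have 2: "\<forall>\<^sub>F k in sequentially. b / real k < \<zeta>"
    using eventually_compose_filterlim filterlim_real_sequentially by blast
  obtain k\<^sub>0 where k\<^sub>0: "\<And>k. k \<ge> k\<^sub>0 \<Longrightarrow> 3 * real k * exp (- (c * sqrt (real k))) < \<zeta> \<and> b / real k < \<zeta>"
    using eventually_conj[OF 1 2] unfolding eventually_sequentially by blast
  have "3 * real k * exp (- (\<zeta> * \<theta> * sqrt (real k) / (4 * (real r)\<^sup>2))) \<le> \<zeta>"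
    "2 / \<theta> * (real r)\<^sup>2 / (\<zeta> * real k) \<le> \<zeta>" if "k \<ge> k\<^sub>0" for k
    using k\<^sub>0[OF that] by (simp_all add: c_def b_def field_simps)
  moreover have "8 * \<zeta> < \<theta> * \<theta> ^ r * (\<theta>\<^sup>2 / 2) ^ r" using \<zeta> unfolding \<zeta>_def by simp
  ultimately show ?thesis using r \<zeta> r2 by blast
qed

text \<open>Each k has its own threshold for n; only finitely many k occur, so one threshold serves
  them all.\<close>

lemma few_parts_parameters:
  fixes \<epsilon> \<delta> :: real
  assumes "0 < \<epsilon>" "0 < \<delta>"
  shows "\<exists>n\<^sub>0. \<forall>n\<ge>n\<^sub>0. \<forall>k\<in>{0<..<k\<^sub>0}.
    ln (3 * (real k)\<^sup>2 * real n) \<le> \<epsilon> * \<delta> * sqrt (real n) / (4 * real k) \<and> 4 * real k \<le> \<epsilon> * real n"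
proof -
  have "\<forall>\<^sub>F n in sequentially. \<forall>k\<in>{0<..<k\<^sub>0}.
    ln (3 * (real k)\<^sup>2 * real n) \<le> \<epsilon> * \<delta> * sqrt (real n) / (4 * real k) \<and> 4 * real k \<le> \<epsilon> * real n"
  proof (intro eventually_ball_finite ballI)
    fix k assume "k \<in> {0<..<k\<^sub>0}"
    define a where "a = 3 * (real k)\<^sup>2"
    define b where "b = \<epsilon> * \<delta> / (4 * real k)"
    have ab: "0 < a" "0 < b" using \<open>k \<in> _\<close> assms by (auto simp: a_def b_def)
    have "\<forall>\<^sub>F x in at_top. ln (a * x) \<le> b * sqrt x \<and> 4 * real k \<le> \<epsilon> * x"
    proof (rule eventually_conj)
      show "\<forall>\<^sub>F x in at_top. ln (a * x) \<le> b * sqrt x" using ab by real_asymp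
      show "\<forall>\<^sub>F x in at_top. 4 * real k \<le> \<epsilon> * x" using assms by real_asymp
    qed
    then have "\<forall>\<^sub>F n in sequentially. ln (a * real n) \<le> b * sqrt (real n) \<and> 4 * real k \<le> \<epsilon> * real n"
      using eventually_compose_filterlim filterlim_real_sequentially by blast
    then show "\<forall>\<^sub>F n in sequentially. ln (3 * (real k)\<^sup>2 * real n) \<le> \<epsilon> * \<delta> * sqrt (real n) / (4 * real k)
      \<and> 4 * real k \<le> \<epsilon> * real n"
      by (simp add: a_def b_def)
  qed simp
  then show ?thesis unfolding eventually_sequentially .
qed

lemma conflict_free_tiling:
  fixes \<epsilon> \<delta> :: real
  assumes \<epsilon>: "0 < \<epsilon>" "\<epsilon> < 1" and \<delta>: "0 < \<delta>" "\<delta> < 1"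
  shows "\<exists>n\<^sub>0>0. \<forall>n\<ge>n\<^sub>0. \<forall>k>0. \<forall>d Q. conflict_system n k d Q \<longrightarrow>
    real k * real d \<le> (1 - \<delta>) * real n \<longrightarrow>
    (\<exists>x t. conflict_system.packing n k Q x t \<and> (1 - \<epsilon>) * real n \<le> real t)"
proof -
  \<comment> \<open>With \<theta> = \<delta>/2, the product (1 + \<theta>)(1 - \<delta>) is at most
    1 - \<theta>, which is the degree condition of \<open>many_parts\<close>.\<close>
  define \<theta> where "\<theta> = \<delta> / 2"
  have \<theta>: "0 < \<theta>" "\<theta> < 1" using \<delta> by (auto simp: \<theta>_def)
  obtain r \<zeta> k\<^sub>0 where P: "0 < r" "0 < \<zeta>" "2 \<le> \<theta> * (1 + \<theta>\<^sup>2 / 2) ^ r"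
    "8 * \<zeta> < \<theta> * \<theta> ^ r * (\<theta>\<^sup>2 / 2) ^ r"
    "\<And>k. k \<ge> k\<^sub>0 \<Longrightarrow> 3 * real k * exp (- (\<zeta> * \<theta> * sqrt (real k) / (4 * (real r)\<^sup>2))) \<le> \<zeta>"
    "\<And>k. k \<ge> k\<^sub>0 \<Longrightarrow> 2 / \<theta> * (real r)\<^sup>2 / (\<zeta> * real k) \<le> \<zeta>"
    using many_parts_parameters[OF \<theta>] by auto
  obtain n\<^sub>0 where n\<^sub>0: "\<And>n k. n \<ge> n\<^sub>0 \<Longrightarrow> 0 < k \<Longrightarrow> k < k\<^sub>0 \<Longrightarrow>
    ln (3 * (real k)\<^sup>2 * real n) \<le> \<epsilon> * \<delta> * sqrt (real n) / (4 * real k) \<and> 4 * real k \<le> \<epsilon> * real n"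
    using few_parts_parameters[OF \<epsilon>(1) \<delta>(1), of k\<^sub>0] by (metis greaterThanLessThan_iff)
  show ?thesis
  \<comment> \<open>The successor keeps n positive, as \<open>many_parts\<close> requires.\<close>
  proof (intro exI[of _ "Suc n\<^sub>0"] conjI allI impI)
    fix n k d :: nat and Q
    assume n: "Suc n\<^sub>0 \<le> n" and k: "0 < k" and Q: "conflict_system n k d Q"
      and d: "real k * real d \<le> (1 - \<delta>) * real n"
    interpret conflict_system n k d Q by (rule Q)
    show "\<exists>x t. packing x t \<and> (1 - \<epsilon>) * real n \<le> real t"
    proof (cases "k < k\<^sub>0")
      case True
      interpret few_parts n k d Q \<epsilon> \<delta>
        by unfold_locales (use \<epsilon> \<delta> k d n\<^sub>0[of n k] n True in auto)
      show ?thesis by (rule almost_perfect_tiling)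
    next
      case False
      have "(1 + \<theta>) * real d * real k = (1 + \<theta>) * (real k * real d)" by simp
      also have "\<dots> \<le> (1 + \<theta>) * ((1 - \<delta>) * real n)" using d \<theta> by (intro mult_left_mono) auto
      also have "\<dots> = ((1 + \<theta>) * (1 - \<delta>)) * real n" by simp
      also have "\<dots> \<le> (1 - \<theta>) * real n"
        using \<delta> by (intro mult_right_mono) (auto simp: \<theta>_def field_simps)
      finally have "(1 + \<theta>) * real d * real k \<le> (1 - \<theta>) * real n" .
      then interpret many_parts n k d Q \<theta> \<zeta> r
        by unfold_locales (use \<theta> P k n False in auto)
      obtain x where x: "partial x k" using perfect_tiling by blast
      have "\<not> Q i (x i c) j (x j c)" if "i < k" "j < k" "i \<noteq> j" "c < n" for i j c
        using x that Q_sym unfolding partial_def by (metis linorder_neqE_nat)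
      moreover have "inj_on (x i) {..<n} \<and> x i ` {..<n} \<subseteq> {..<n}" if "i < k" for i
        using x that by (auto simp: partial_def bij_betw_def)
      moreover have "(1 - \<epsilon>) * real n \<le> real n" using \<epsilon> by (simp add: mult_left_le_one_le)
      ultimately show ?thesis unfolding packing_def by blast
    qed
  qed simp
qed

section \<open>From tilings back to graphs\<close>

lemma disjoint_cliques_from_tiling:
  fixes V :: "nat \<Rightarrow> 'a set"
  assumes V: "disjoint_family_on V {..<k}" and k: "0 < k"
    and f: "\<And>i. i < k \<Longrightarrow> bij_betw (f i) {..<n} (V i)"
    and x: "\<And>i. i < k \<Longrightarrow> inj_on (x i) {..<t} \<and> x i ` {..<t} \<subseteq> {..<n::nat}"
    and E: "\<And>i j c. i < k \<Longrightarrow> j < k \<Longrightarrow> i \<noteq> j \<Longrightarrow> c < t \<Longrightarrow> {f i (x i c), f j (x j c)} \<in> E"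
  shows "\<exists>T. T \<subseteq> complete_copies k (\<Union>i<k. V i) E \<and> finite T \<and> pairwise disjnt T \<and> card T = t"
proof -
  define g where "g c i = f i (x i c)" for c i
  define C where "C c = g c ` {..<k}" for c
  have gV: "g c i \<in> V i" if "i < k" "c < t" for c i
    using f[OF that(1)] x[OF that(1)] that(2) unfolding g_def bij_betw_def by blast
  have g_eq: "i = j \<and> c = c'" if "g c i = g c' j" "i < k" "j < k" "c < t" "c' < t" for i j c c'
  proof -
    have "V i \<inter> V j \<noteq> {}" using gV[of i c] gV[of j c'] that by auto
    then have ij: "i = j" using V that by (auto simp: disjoint_family_on_def)
    have "x i c < n" "x i c' < n" using x[OF \<open>i < k\<close>] that by auto
    then have "x i c = x i c'"
      using f[OF \<open>i < k\<close>] that(1) ij by (auto simp: g_def bij_betw_def inj_on_def)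
    then show ?thesis using x[OF \<open>i < k\<close>] that ij by (auto simp: inj_on_def)
  qed
  have C: "C c \<in> complete_copies k (\<Union>i<k. V i) E" if "c < t" for c
  proof -
    have "inj_on (g c) {..<k}" using g_eq that by (auto intro!: inj_onI)
    then have "card (C c) = k" by (simp add: C_def card_image)
    moreover have "C c \<subseteq> (\<Union>i<k. V i)" using gV that by (auto simp: C_def)
    moreover have "clique (C c) E"
      unfolding clique_def C_def using E that by (auto simp: g_def)
    ultimately show ?thesis by (simp add: complete_copies_def nsets_def C_def)
  qed
  have disj: "disjnt (C c) (C c')" if "c < t" "c' < t" "c \<noteq> c'" for c c'
    using g_eq that unfolding disjnt_def C_def by blast
  \<comment> \<open>Disjoint sets are distinct only if one is nonempty; this is what makes C
    injective.\<close>
  have ne: "C c \<noteq> {}" for c using k by (auto simp: C_def)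
  have "inj_on C {..<t}"
    by (rule inj_onI) (metis disj disjnt_self_iff_empty lessThan_iff ne)
  then have "card (C ` {..<t}) = t" by (simp add: card_image)
  moreover have "pairwise disjnt (C ` {..<t})"
    by (auto simp: pairwise_def intro: disj)
  moreover have "C ` {..<t} \<subseteq> complete_copies k (\<Union>i<k. V i) E" using C by auto
  ultimately show ?thesis by (intro exI[of _ "C ` {..<t}"]) simp
qed

theorem theorem1p6:
  fixes \<epsilon> \<delta> :: real
  assumes "0 < \<epsilon>" and "\<epsilon> < 1" and "0 < \<delta>" and "\<delta> < 1"
  shows "\<exists>n\<^sub>0::nat. \<forall>n\<ge>n\<^sub>0. \<forall>k\<ge>2. \<forall>(V :: nat \<Rightarrow> 'a set) E.
    partite_graph k V E \<and> (\<forall>i<k. finite (V i) \<and> card (V i) = n) \<and>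
    real (partite_min_degree k V E) \<ge> (1 - (1 - \<delta>) / real k) * real n \<longrightarrow>
    (\<exists>T. T \<subseteq> complete_copies k (\<Union>i<k. V i) E \<and> finite T \<and> pairwise disjnt T \<and>
      real (card T) \<ge> (1 - \<epsilon>) * real n)"
proof -
  obtain n\<^sub>0 where n\<^sub>0: "n\<^sub>0 > 0" and tiling: "\<forall>n\<ge>n\<^sub>0. \<forall>k>0. \<forall>d Q. conflict_system n k d Q \<longrightarrow>
    real k * real d \<le> (1 - \<delta>) * real n \<longrightarrow>
    (\<exists>x t. conflict_system.packing n k Q x t \<and> (1 - \<epsilon>) * real n \<le> real t)"
    using conflict_free_tiling[OF assms] by (elim exE conjE)
  show ?thesis
  proof (intro exI[of _ n\<^sub>0] allI impI, elim conjE)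
    fix n k and V :: "nat \<Rightarrow> 'a set" and E
    assume n: "n\<^sub>0 \<le> n" and k: "2 \<le> k" and G: "partite_graph k V E"
      and V: "\<forall>i<k. finite (V i) \<and> card (V i) = n"
      and deg: "(1 - (1 - \<delta>) / real k) * real n \<le> real (partite_min_degree k V E)"
    \<comment> \<open>With empty parts the \<open>GREATEST\<close> in the minimum degree would not
      be attained; positive n rules this out.\<close>
    have ne: "V i \<noteq> {}" if "i < k" for i using V that n n\<^sub>0 by fastforce
    define m where "m = partite_min_degree k V E"
    have m: "m \<le> card {u\<in>V j. {v, u} \<in> E}" if "i < k" "j < k" "i \<noteq> j" "v \<in> V i" for i j v
      using le_partite_min_degree_iff[of k V m E, OF k ne] that by (auto simp: m_def)
    have "\<forall>i. \<exists>f. i < k \<longrightarrow> bij_betw f {..<n} (V i)"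
      using V ex_bij_betw_nat_finite by (metis atLeast0LessThan)
    then obtain f where f: "\<And>i. i < k \<Longrightarrow> bij_betw (f i) {..<n} (V i)" by metis
    define Q where "Q i u j v \<longleftrightarrow> {f i u, f j v} \<notin> E" for i u j v
    have nonadj: "card {v. v < n \<and> Q i u j v} + m \<le> n" if "i < k" "j < k" "i \<noteq> j" "u < n" for i j u
    proof -
      have fu: "f i u \<in> V i" using f[OF that(1)] that(4) by (auto simp: bij_betw_def)
      have "f j ` {v. v < n \<and> Q i u j v} \<subseteq> V j - {w\<in>V j. {f i u, w} \<in> E}"
        using f[OF that(2)] by (auto simp: bij_betw_def Q_def)
      moreover have "inj_on (f j) {v. v < n \<and> Q i u j v}"
        using f[OF that(2)] by (auto simp: bij_betw_def intro: inj_on_subset)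
      ultimately have "card {v. v < n \<and> Q i u j v} \<le> card (V j - {w\<in>V j. {f i u, w} \<in> E})"
        using V that(2) by (intro card_inj_on_le[of "f j"]) auto
      also have "\<dots> = n - card {w\<in>V j. {f i u, w} \<in> E}"
        using V that(2) by (subst card_Diff_subset) auto
      finally have "card {v. v < n \<and> Q i u j v} \<le> n - card {w\<in>V j. {f i u, w} \<in> E}" .
      moreover have "card {w\<in>V j. {f i u, w} \<in> E} \<le> n"
        using V that(2) card_mono[of "V j" "{w\<in>V j. {f i u, w} \<in> E}"] by auto
      ultimately show ?thesis using m[OF that(1-3) fu] by linarith
    qed
    interpret conflict_system n k "n - m" Q
    proof
      show "Q i u j v \<longleftrightarrow> Q j v i u" for i u j v by (simp add: Q_def insert_commute)
      show "card {v. v < n \<and> Q i u j v} \<le> n - m" if "i < k" "j < k" "i \<noteq> j" "u < n" for i j u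
        using nonadj[OF that] by linarith
    qed
    have "real k * real (n - m) \<le> (1 - \<delta>) * real n"
    proof -
      \<comment> \<open>The parts 0 and 1 exist because k >= 2; the bound makes the natural
        subtraction n - m exact.\<close>
      have "m \<le> n" using nonadj[of 0 1 0] k n n\<^sub>0 by simp
      then have "real k * real (n - m) = real k * real n - real k * real m"
        by (simp add: of_nat_diff right_diff_distrib)
      also have "\<dots> \<le> real k * real n - real k * ((1 - (1 - \<delta>) / real k) * real n)"
        using deg by (intro diff_left_mono mult_left_mono) (auto simp: m_def)
      also have "\<dots> = (1 - \<delta>) * real n" using k by (simp add: field_simps)
      finally show ?thesis .
    qed
    then obtain x t where x: "packing x t" "(1 - \<epsilon>) * real n \<le> real t"
      using tiling[rule_format, OF n, of k "n - m" Q] k conflict_system_axioms by auto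
    have "\<exists>T. T \<subseteq> complete_copies k (\<Union>i<k. V i) E \<and> finite T \<and> pairwise disjnt T \<and> card T = t"
    proof (rule disjoint_cliques_from_tiling[OF _ _ f])
      show "disjoint_family_on V {..<k}" using G by (simp add: partite_graph_def)
      show "{f i (x i c), f j (x j c)} \<in> E" if "i < k" "j < k" "i \<noteq> j" "c < t" for i j c
        using x(1) that by (simp add: packing_def Q_def)
    qed (use k x(1) in \<open>auto simp: packing_def\<close>)
    then show "\<exists>T. T \<subseteq> complete_copies k (\<Union>i<k. V i) E \<and> finite T \<and> pairwise disjnt T \<and>
      (1 - \<epsilon>) * real n \<le> real (card T)"
      using x(2) by auto
  qed
qed

end
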